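(* Let $f$ be the random multiplicative cascade function generated by $W$, and assume that either (i) the cascade is subcritical, i.e. $\mathbb{E}(W\log_2 W)<1$; or (ii) the cascade is critical, i.e. $\mathbb{E}(W\log_2 W)=1$, and additionally $\mathbb{E}(W^{-t})<\infty$ for some $t>0$ and $\mathbb{E}(W\log^2 W)<\infty$. Let $E\subset[0,1]$ be non-empty and compact, and let $d_E=\overline{\dim}_{\mathrm B}\,E$. Then almost surely $\overline{\dim}_{\mathrm B}\, f(E)\leq s$, where $s$ is the unique number in $[0,1]$ satisfying $$2^{d_E}=\frac{2^s}{\mathbb{E}(W^s)}.$$
   Context: $\overline{\dim}_{\mathrm B}$ denotes the upper box-counting dimension: $\overline{\dim}_{\mathrm B}E=\limsup_{r\to0}\log N_r(E)/(-\log r)$, where $N_r(E)$ is the minimal number of sets of diameter at most $r$ needed to cover $E$. Random cascade. $W$ is a positive random variable, not almost surely constant, with $\mathbb{E}(W)=1$ and $\mathbb{E}(W\log_2 W)\le 1$. Let $\{W_{\mathbf i}\}$, indexed by non-empty finite words $\mathbf i$ over $\{0,1\}$, be independent random variables with the distribution of $W$. For $\mathbf i=i_1\dots i_k\in\{0,1\}^k$ ($k\ge0$) let $I_{\mathbf i}=\big[\sum_{j=1}^k2^{-j}i_j,\ \sum_{j=1}^k2^{-j}i_j+2^{-k}\big)$ be the corresponding dyadic interval (the rightmost one being taken closed). Words are combined by juxtaposition. Subcritical case ($\mathbb{E}(W\log_2W)<1$): $\mu$ is the random measure on $[0,1]$ with $\mu(I_{\mathbf i})=2^{-k}W_{i_1}W_{i_1i_2}\cdots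 W_{i_1\dots i_k}L_{\mathbf i}$, where $L_{\mathbf i}=\lim_{n\to\infty}\sum_{\mathbf j\in\{0,1\}^n}2^{-n}W_{\mathbf i j_1}\cdots W_{\mathbf i j_1\dots j_n}$ (almost sure limit). Critical case ($\mathbb{E}(W\log_2W)=1$, under $\mathbb{E}(W\log^2W)<\infty$): $\mu$ is the random measure on $[0,1]$ with $\mu(I_{\mathbf i})=2^{-k}W_{i_1}W_{i_1i_2}\cdots W_{i_1\dots i_k}L_{\mathbf i}$, where now $L_{\mathbf i}=\lim_{n\to\infty}\sqrt n\sum_{\mathbf j\in\{0,1\}^n}2^{-n}W_{\mathbf i j_1}\cdots W_{\mathbf i j_1\dots j_n}$, the limit being in probability. In both cases the multiplicative cascade function is $f:[0,1]\to[0,\infty)$, $f(x)=\mu([0,x))$, which is almost surely strictly increasing and continuous. The function $s\mapsto 2^s/\mathbb{E}(W^s)$ is continuous and strictly increasing from $[0,1]$ onto $[1,2]$. *)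

theory Defs
  imports "HOL-Probability.Probability"
begin

(* The library's diameter is meaningful on bounded sets only, hence the boundedness requirement.
   For sets that are not totally bounded no finite cover exists and the value is unspecified. *)
definition covering_number :: "real \<Rightarrow> 'a::metric_space set \<Rightarrow> nat" where
  "covering_number r E =
     (LEAST n. \<exists>\<C>. finite \<C> \<and> card \<C> = n \<and> (\<forall>U\<in>\<C>. bounded U \<and> diameter U \<le> r) \<and> E \<subseteq> \<Union>\<C>)"

definition upper_box_dim :: "'a::metric_space set \<Rightarrow> ereal" where
  "upper_box_dim E =
     Limsup (at_right 0) (\<lambda>r. ereal (ln (real (covering_number r E)) / (- ln r)))"

definition limit_in_probability :: "'a measure \<Rightarrow> (nat \<Rightarrow> 'a \<Rightarrow> real) \<Rightarrow> ('a \<Rightarrow> real) \<Rightarrow> bool" where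
  "limit_in_probability M X Y \<longleftrightarrow>
     (\<forall>\<epsilon>>0. (\<lambda>n. measure M {\<omega> \<in> space M. \<bar>X n \<omega> - Y \<omega>\<bar> > \<epsilon>}) \<longlonglongrightarrow> 0)"

(* Words over {0,1} are lists of booleans, True being the letter 1; words are combined by @. *)

definition dyadic_left :: "bool list \<Rightarrow> real" where
  "dyadic_left w = (\<Sum>j=1..length w. of_bool (w ! (j - 1)) / 2 ^ j)"

(* The rightmost interval of a generation, closed on the right, belongs to the word 11...1
   (the empty word in generation 0). *)
definition dyadic_interval :: "bool list \<Rightarrow> real set" where
  "dyadic_interval w =
     (if \<forall>b\<in>set w. b then {dyadic_left w .. dyadic_left w + 1 / 2 ^ length w}
      else {dyadic_left w ..< dyadic_left w + 1 / 2 ^ length w})"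

definition cascade_generator :: "'a measure \<Rightarrow> ('a \<Rightarrow> real) \<Rightarrow> bool" where
  "cascade_generator M W \<longleftrightarrow>
     W \<in> borel_measurable M \<and>
     (AE \<omega> in M. W \<omega> > 0) \<and>
     \<not> (\<exists>c. AE \<omega> in M. W \<omega> = c) \<and>
     integrable M W \<and> (\<integral>\<omega>. W \<omega> \<partial>M) = 1"

definition cascade_weights :: "'a measure \<Rightarrow> ('a \<Rightarrow> real) \<Rightarrow> (bool list \<Rightarrow> 'a \<Rightarrow> real) \<Rightarrow> bool" where
  "cascade_weights M W V \<longleftrightarrow>
     prob_space.indep_vars M (\<lambda>_. borel) V {w. w \<noteq> []} \<and>
     (\<forall>w. w \<noteq> [] \<longrightarrow> distr M borel (V w) = distr M borel W)"

(* For u = [] and w = i1...ik this is W_{i1} W_{i1 i2} ... W_{i1...ik}. *)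
definition cascade_prod :: "(bool list \<Rightarrow> 'a \<Rightarrow> real) \<Rightarrow> bool list \<Rightarrow> bool list \<Rightarrow> 'a \<Rightarrow> real" where
  "cascade_prod V u w \<omega> = (\<Prod>k=1..length w. V (u @ take k w) \<omega>)"

definition cascade_sum :: "(bool list \<Rightarrow> 'a \<Rightarrow> real) \<Rightarrow> bool list \<Rightarrow> nat \<Rightarrow> 'a \<Rightarrow> real" where
  "cascade_sum V u n \<omega> = (\<Sum>w\<in>{w. length w = n}. cascade_prod V u w \<omega> / 2 ^ n)"

(* Integrability is required explicitly since the Bochner integral of a non-integrable function
   is 0. As x log x is bounded below, it is equivalent to the expectation, which always exists
   in (-oo, oo], being finite. *)
definition subcritical :: "'a measure \<Rightarrow> ('a \<Rightarrow> real) \<Rightarrow> bool" where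
  "subcritical M W \<longleftrightarrow>
     integrable M (\<lambda>\<omega>. W \<omega> * log 2 (W \<omega>)) \<and> (\<integral>\<omega>. W \<omega> * log 2 (W \<omega>) \<partial>M) < 1"

definition critical :: "'a measure \<Rightarrow> ('a \<Rightarrow> real) \<Rightarrow> bool" where
  "critical M W \<longleftrightarrow>
     integrable M (\<lambda>\<omega>. W \<omega> * log 2 (W \<omega>)) \<and> (\<integral>\<omega>. W \<omega> * log 2 (W \<omega>) \<partial>M) = 1"

definition subcritical_limit ::
  "'a measure \<Rightarrow> (bool list \<Rightarrow> 'a \<Rightarrow> real) \<Rightarrow> (bool list \<Rightarrow> 'a \<Rightarrow> real) \<Rightarrow> bool" where
  "subcritical_limit M V L \<longleftrightarrow>
     (\<forall>u. L u \<in> borel_measurable M \<and>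
          (AE \<omega> in M. (\<lambda>n. cascade_sum V u n \<omega>) \<longlonglongrightarrow> L u \<omega>))"

definition critical_limit ::
  "'a measure \<Rightarrow> (bool list \<Rightarrow> 'a \<Rightarrow> real) \<Rightarrow> (bool list \<Rightarrow> 'a \<Rightarrow> real) \<Rightarrow> bool" where
  "critical_limit M V L \<longleftrightarrow>
     (\<forall>u. L u \<in> borel_measurable M \<and>
          limit_in_probability M (\<lambda>n \<omega>. sqrt (real n) * cascade_sum V u n \<omega>) (L u))"

(* The values on dyadic intervals determine the measure almost surely. *)
definition cascade_measure ::
  "'a measure \<Rightarrow> (bool list \<Rightarrow> 'a \<Rightarrow> real) \<Rightarrow> (bool list \<Rightarrow> 'a \<Rightarrow> real) \<Rightarrow> ('a \<Rightarrow> real measure) \<Rightarrow> bool"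
where
  "cascade_measure M V L \<mu> \<longleftrightarrow>
     (AE \<omega> in M. sets (\<mu> \<omega>) = sets (restrict_space borel {0..1}) \<and>
        (\<forall>w. emeasure (\<mu> \<omega>) (dyadic_interval w) =
              ennreal (cascade_prod V [] w \<omega> / 2 ^ length w * L w \<omega>)))"

definition cascade_function :: "('a \<Rightarrow> real measure) \<Rightarrow> 'a \<Rightarrow> real \<Rightarrow> real" where
  "cascade_function \<mu> \<omega> x = measure (\<mu> \<omega>) {0..<x}"

end

theory Submission
  imports Defs "HOL-Real_Asymp.Real_Asymp"
begin

text \<open>
  For \<open>r > 0\<close>, stop the descent of the dyadic tree at the first interval whose mass is at most \<open>r\<close>.
  The images of the stopped intervals meeting \<open>E\<close> cover \<open>f E\<close> by sets of diameter at most \<open>r\<close>, and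
  their number is at most one plus twice the number of dyadic intervals that meet \<open>E\<close> and have mass
  exceeding \<open>r\<close>. By Markov's inequality that number is \<open>O (r powr (- t))\<close> as soon as the masses to
  the power \<open>t\<close>, over all dyadic intervals meeting \<open>E\<close>, have a finite sum. Its expectation is at most
  the sum over \<open>n\<close> of \<open>N n * (E (W powr t) / 2 powr t) ^ n * sup E (L powr t)\<close>, where \<open>N n\<close> counts the
  intervals of generation \<open>n\<close> meeting \<open>E\<close>, and this converges for every \<open>t > s\<close> with
  \<open>sup E (L powr t) < \<infinity>\<close>.

  These moments are bounded by Fatou's lemma in the subcritical case. In the critical case let
  \<open>g t = 1 - E (exp (- t * L))\<close>. The branching structure gives \<open>g t = q t * (2 - q t)\<close> with
  \<open>q t = E (g (t * W / 2))\<close>, so that \<open>g t / t\<close>, as a function of \<open>y = - ln t\<close>, is nearly harmonic for a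
  centred random walk with finite variance. Being monotone, it must grow subexponentially in \<open>y\<close>,
  that is, \<open>g t = O (t powr a)\<close> for every \<open>a < 1\<close>, whence all moments of order less than \<open>1\<close> are finite.
\<close>

subsection \<open>Covering numbers and dyadic intervals\<close>

text \<open>In the critical case \<open>sqrt n * cascade_sum V u n\<close> has mean
  \<open>sqrt n\<close>, so Fatou's lemma yields no moment bound. Laplace transforms take its place:
  those of \<open>cascade_sum V u n\<close> obey an exact recursion in \<open>n\<close> involving
  only the law of \<open>W\<close>, so they do not depend on the root \<open>u\<close>, and neither
  do the transforms of the limits \<open>L u\<close>. The equation for \<open>g\<close> is the limit
  of this recursion. A parabola serves as comparison function because the second moment of the walk
  is finite.

  Since \<open>L u\<close> is known only as a limit, its independence from the weights above
  \<open>u\<close> is used at finite stages and then carried over.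

  Exponents \<open>t > s\<close> are taken because at \<open>s\<close> itself the ratio
  \<open>2 powr d * E (W powr s) / 2 powr s\<close>, with \<open>d\<close> the dimension of
  \<open>E\<close>, is exactly 1. Passing to \<open>t\<close> also leaves room for a slightly larger
  \<open>d\<close>, for which the covering numbers really are bounded by powers. If
  \<open>s = 1\<close> there is no exponent between \<open>s\<close> and 1, but then the claim only
  says that a bounded subset of the line has dimension at most 1.\<close>

lemma covering_number_le:
  assumes "finite \<C>" "\<And>U. U \<in> \<C> \<Longrightarrow> bounded U \<and> diameter U \<le> r" "A \<subseteq> \<Union>\<C>"
  shows "covering_number r A \<le> card \<C>"
  unfolding covering_number_def using assms by (intro Least_le) blast

lemma bounded_real_cover:
  fixes A :: "real set"
  assumes "A \<subseteq> {a..b}" "0 < r" "a \<le> b"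
  obtains \<C> where "finite \<C>" "\<And>U. U \<in> \<C> \<Longrightarrow> bounded U \<and> diameter U \<le> r" "A \<subseteq> \<Union>\<C>"
    "real (card \<C>) \<le> (b - a) / r + 1"
proof -
  define K where "K = nat \<lfloor>(b - a) / r\<rfloor>"
  define I where "I k = {a + real k * r .. a + (real k + 1) * r}" for k :: nat
  have K: "real K \<le> (b - a) / r"
    unfolding K_def using assms by simp
  have "bounded (I k) \<and> diameter (I k) \<le> r" for k
  proof -
    have "a + real k * r \<le> a + (real k + 1) * r"
      using assms by (simp add: algebra_simps)
    then show ?thesis
      unfolding I_def by (simp add: algebra_simps diameter_closed_interval)
  qed
  moreover have "A \<subseteq> \<Union>(I ` {..K})"
  proof
    fix x assume "x \<in> A"
    then have x: "a \<le> x" "x \<le> b" using assms by auto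
    define k where "k = nat \<lfloor>(x - a) / r\<rfloor>"
    have "0 \<le> (x - a) / r" using x assms by simp
    then have k: "real k \<le> (x - a) / r" "(x - a) / r < real k + 1"
      unfolding k_def by linarith+
    have "k \<le> K"
      unfolding k_def K_def using x assms by (intro nat_mono floor_mono divide_right_mono) auto
    moreover have "x \<in> I k"
      unfolding I_def using k \<open>0 < r\<close> by (simp add: field_simps)
    ultimately show "x \<in> \<Union>(I ` {..K})" by auto
  qed
  moreover have "real (card (I ` {..K})) \<le> (b - a) / r + 1"
    using card_image_le[of "{..K}" I] K by simp
  ultimately show ?thesis by (intro that[of "I ` {..K}"]) auto
qed

text \<open>The existence of some finite cover, from \<open>bounded_real_cover\<close>, is what
  gives the \<open>LEAST\<close> in \<open>covering_number\<close> its meaning.\<close>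

lemma covering_number_attained:
  fixes A :: "real set"
  assumes "A \<subseteq> {a..b}" "0 < r" "a \<le> b"
  obtains \<C> where "finite \<C>" "card \<C> = covering_number r A"
    "\<And>U. U \<in> \<C> \<Longrightarrow> bounded U \<and> diameter U \<le> r" "A \<subseteq> \<Union>\<C>"
proof -
  have "\<exists>n \<C>. finite \<C> \<and> card \<C> = n \<and> (\<forall>U\<in>\<C>. bounded U \<and> diameter U \<le> r) \<and> A \<subseteq> \<Union>\<C>"
    using bounded_real_cover[OF assms] by metis
  from LeastI_ex[OF this] that show ?thesis
    unfolding covering_number_def by blast
qed

lemma ln_of_nat_nonneg: "0 \<le> ln (real n)"
  by (cases "n = 0") auto

text \<open>A constant factor \<open>C\<close> in the covering bound adds only
  \<open>ln C / (- ln r)\<close>, which vanishes as \<open>r\<close> tends to 0.\<close>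

lemma upper_box_dim_le:
  assumes "1 \<le> C" "0 \<le> s"
    and "\<And>r. 0 < r \<Longrightarrow> r < 1 \<Longrightarrow> real (covering_number r A) \<le> C * r powr (- s)"
  shows "upper_box_dim A \<le> ereal s"
proof -
  have "((\<lambda>r. s + ln C / (- ln r)) \<longlongrightarrow> s) (at_right 0)"
    by real_asymp
  then have lim: "Limsup (at_right 0) (\<lambda>r. ereal (s + ln C / (- ln r))) = ereal s"
    by (intro lim_imp_Limsup) auto
  have "ln (real (covering_number r A)) / (- ln r) \<le> s + ln C / (- ln r)"
    if r: "0 < r" "r < 1" for r :: real
  proof -
    have ln: "ln r < 0" using r by simp
    have "1 \<le> r powr (- s)"
      using r assms(2) by (simp add: powr_minus powr_le1 one_le_inverse)
    \<comment> \<open>This serves the covering number 0, for which the left-hand side below is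
      \<open>ln 0 = 0\<close>.\<close>
    then have C1: "1 \<le> C * r powr (- s)"
      using assms(1) by (metis mult_mono' mult_1 zero_le_one)
    have "ln (real (covering_number r A)) \<le> ln (C * r powr (- s))"
    proof (cases "covering_number r A = 0")
      case True
      then show ?thesis using C1 by simp
    next
      case False
      then show ?thesis using assms(3)[OF r] by (intro ln_mono) auto
    qed
    also have "\<dots> = ln C - s * ln r"
      using assms(1) r by (simp add: ln_mult ln_powr)
    finally have "ln (real (covering_number r A)) / (- ln r) \<le> (ln C - s * ln r) / (- ln r)"
      using ln by (intro divide_right_mono) auto
    also have "\<dots> = s + ln C / (- ln r)"
      using ln by (simp add: field_simps)
    finally show ?thesis .
  qed
  then have "eventually (\<lambda>r. ereal (ln (real (covering_number r A)) / (- ln r))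
      \<le> ereal (s + ln C / (- ln r))) (at_right 0)"
    by (auto simp: eventually_at_right[of 0 1] intro!: exI[of _ 1])
  from Limsup_mono[OF this] show ?thesis
    unfolding upper_box_dim_def lim .
qed

lemma upper_box_dim_nonneg: "0 \<le> upper_box_dim A"
proof -
  have "0 \<le> ln (real (covering_number r A)) / (- ln r)" if "0 < r" "r < 1" for r :: real
    using that by (intro divide_nonneg_nonneg ln_of_nat_nonneg) auto
  then have "eventually (\<lambda>r. 0 \<le> ereal (ln (real (covering_number r A)) / (- ln r))) (at_right 0)"
    by (auto simp: eventually_at_right[of 0 1] intro!: exI[of _ 1])
  then show ?thesis
    unfolding upper_box_dim_def by (intro le_Limsup) auto
qed

lemma upper_box_dim_bounded_real_le_1:
  fixes A :: "real set"
  assumes "A \<subseteq> {a..b}" "a \<le> b"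
  shows "upper_box_dim A \<le> 1"
proof -
  have "real (covering_number r A) \<le> (b - a + 1) * r powr (- 1)" if r: "0 < r" "r < 1" for r
  proof -
    obtain \<C> where \<C>: "finite \<C>" "\<And>U. U \<in> \<C> \<Longrightarrow> bounded U \<and> diameter U \<le> r" "A \<subseteq> \<Union>\<C>"
      "real (card \<C>) \<le> (b - a) / r + 1"
      by (rule bounded_real_cover[OF assms(1) r(1) assms(2)]) blast
    have "real (covering_number r A) \<le> (b - a) / r + 1"
      using covering_number_le[OF \<C>(1-3)] \<C>(4) by linarith
    also have "\<dots> \<le> (b - a) / r + 1 / r"
      using r by simp
    finally show ?thesis
      using r by (simp add: powr_minus divide_simps)
  qed
  then have "upper_box_dim A \<le> ereal 1"
    using assms(2) by (intro upper_box_dim_le[of "b - a + 1"]) auto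
  then show ?thesis by (simp add: one_ereal_def)
qed

lemma covering_number_powr_bound:
  assumes "upper_box_dim A < ereal d"
  shows "eventually (\<lambda>r. real (covering_number r A) \<le> r powr (- d)) (at_right 0)"
proof -
  have "eventually (\<lambda>r. ereal (ln (real (covering_number r A)) / (- ln r)) < ereal d) (at_right 0)"
    using assms unfolding upper_box_dim_def by (rule Limsup_lessD)
  moreover have "eventually (\<lambda>r::real. 0 < r \<and> r < 1) (at_right 0)"
    by (auto simp: eventually_at_right[of 0 1] intro!: exI[of _ 1])
  ultimately show ?thesis
  proof eventually_elim
    case (elim r)
    then have "ln (real (covering_number r A)) < - d * ln r"
      using ln_less_zero[of r] by (simp add: field_simps)
    moreover have "r powr (- d) = exp (- d * ln r)"
      using elim by (simp add: powr_def)
    moreover have "real (covering_number r A) \<le> exp (ln (real (covering_number r A)))"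
      by (cases "covering_number r A = 0") auto
    ultimately show ?case
      by (smt (verit) exp_less_cancel_iff)
  qed
qed

section \<open>Dyadic intervals and the words whose intervals meet a given set\<close>

lemma dyadic_left_Nil [simp]: "dyadic_left [] = 0"
  by (simp add: dyadic_left_def)

lemma dyadic_left_snoc:
  "dyadic_left (w @ [b]) = dyadic_left w + of_bool b / 2 ^ Suc (length w)"
proof -
  have "(\<Sum>j=1..length w. of_bool ((w @ [b]) ! (j - 1)) / 2 ^ j) = dyadic_left w"
    unfolding dyadic_left_def by (intro sum.cong) (auto simp: nth_append)
  then show ?thesis
    unfolding dyadic_left_def by simp
qed

lemma dyadic_left_integer: "\<exists>k::int. dyadic_left w * 2 ^ length w = of_int k"
proof (induction w rule: rev_induct)
  case (snoc b w)
  then obtain k :: int where "dyadic_left w * 2 ^ length w = of_int k" by blast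
  then have "dyadic_left (w @ [b]) * 2 ^ length (w @ [b]) = of_int (2 * k + of_bool b)"
    by (simp add: dyadic_left_snoc field_simps)
  then show ?case by blast
qed simp

text \<open>Scaled to its generation, a left endpoint is an integer whose parity is the last letter,
  so the word can be read off from its end.\<close>

lemma dyadic_left_inj: "length w = length w' \<Longrightarrow> dyadic_left w = dyadic_left w' \<Longrightarrow> w = w'"
proof (induction w arbitrary: w' rule: rev_induct)
  case (snoc b w)
  then obtain v c where w': "w' = v @ [c]"
    by (metis length_0_conv rev_exhaust snoc_eq_iff_butlast)
  have len: "length v = length w" using snoc.prems w' by simp
  obtain k l :: int where kl: "dyadic_left w * 2 ^ length w = of_int k"
    "dyadic_left v * 2 ^ length v = of_int l"
    using dyadic_left_integer by blast
  have "real_of_int (2 * k + of_bool b) = real_of_int (2 * l + of_bool c)"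
    using snoc.prems(2) kl len unfolding w' dyadic_left_snoc by (simp add: field_simps)
  then have *: "2 * k + of_bool b = 2 * l + of_bool c"
    using of_int_eq_iff by blast
  then have "b = c" by (cases b; cases c) (simp_all, presburger+)
  moreover from this * have "k = l" by simp
  then have "dyadic_left w * 2 ^ length w = dyadic_left v * 2 ^ length w" using kl len by metis
  then have "dyadic_left w = dyadic_left v" by simp
  then have "w = v" using snoc.IH len by simp
  ultimately show ?case by (simp add: w')
qed simp

lemma dyadic_interval_Nil: "dyadic_interval [] = {0..1}"
  by (simp add: dyadic_interval_def)

lemma dyadic_interval_snoc_subset: "dyadic_interval (w @ [b]) \<subseteq> dyadic_interval w"
proof -
  define e :: real where "e = 1 / 2 ^ Suc (length w)"
  have e: "0 < e" "1 / 2 ^ length w = 2 * e" "of_bool b / 2 ^ Suc (length w) = of_bool b * e"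
    "1 / 2 ^ length (w @ [b]) = e"
    unfolding e_def by simp_all
  show ?thesis
    unfolding dyadic_interval_def dyadic_left_snoc e using e(1) by (cases b) auto
qed

lemma dyadic_interval_children:
  "dyadic_interval w \<subseteq> dyadic_interval (w @ [False]) \<union> dyadic_interval (w @ [True])"
proof -
  define e :: real where "e = 1 / 2 ^ Suc (length w)"
  have e: "0 < e" "1 / 2 ^ length w = 2 * e" "of_bool b / 2 ^ Suc (length w) = of_bool b * e"
    "1 / 2 ^ length (w @ [b]) = e" for b
    unfolding e_def by simp_all
  show ?thesis
    unfolding dyadic_interval_def dyadic_left_snoc e using e(1) by auto
qed

lemma dyadic_interval_subset_unit: "dyadic_interval w \<subseteq> {0..1}"
proof (induction w rule: rev_induct)
  case (snoc b w)
  then show ?case using dyadic_interval_snoc_subset[of w b] by blast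
qed (simp add: dyadic_interval_Nil)

lemma dyadic_interval_bounds:
  "x \<in> dyadic_interval w \<Longrightarrow> dyadic_left w \<le> x \<and> x \<le> dyadic_left w + 1 / 2 ^ length w"
  unfolding dyadic_interval_def by (auto split: if_splits)

lemma dyadic_interval_convex:
  "x \<in> dyadic_interval w \<Longrightarrow> y \<in> dyadic_interval w \<Longrightarrow> {x..<y} \<subseteq> dyadic_interval w"
  unfolding dyadic_interval_def by (auto split: if_splits)

lemma dyadic_interval_borel: "dyadic_interval w \<in> sets borel"
  unfolding dyadic_interval_def by auto

definition words_meeting :: "real set \<Rightarrow> nat \<Rightarrow> bool list set" where
  "words_meeting E n = {w. length w = n \<and> dyadic_interval w \<inter> E \<noteq> {}}"

lemma finite_words: "finite {w :: bool list. length w = n}"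
  using finite_lists_length_eq[of "UNIV :: bool set" n] by simp

lemma finite_words_meeting: "finite (words_meeting E n)"
  using finite_words[of n] unfolding words_meeting_def by (rule rev_finite_subset) auto

lemma card_words_meeting_small:
  assumes "bounded U" "diameter U \<le> 1 / 2 ^ n"
  shows "card (words_meeting U n) \<le> 4"
proof (cases "U = {}")
  case True
  then show ?thesis by (simp add: words_meeting_def)
next
  case False
  then obtain z where z: "z \<in> U" by blast
  define f where "f w = \<lfloor>dyadic_left w * 2 ^ n\<rfloor>" for w
  have fw: "of_int (f w) = dyadic_left w * 2 ^ n" if "length w = n" for w
    using dyadic_left_integer[of w] that unfolding f_def by fastforce
  have inj: "inj_on f (words_meeting U n)"
    by (rule inj_onI) (metis (mono_tags, lifting) words_meeting_def mem_Collect_eq fw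
        dyadic_left_inj mult_right_cancel power_not_zero zero_neq_numeral)
  \<comment> \<open>Scaled by \<open>2 ^ n\<close>, the interval of \<open>w\<close> has length 1
    and contains a point within distance 1 of \<open>z * 2 ^ n\<close>. Its left endpoint therefore
    lies in a window of length 3, and such a window contains at most four integers.\<close>
  have "f w \<in> {\<lfloor>z * 2 ^ n\<rfloor> - 2 .. \<lfloor>z * 2 ^ n\<rfloor> + 1}" if w: "w \<in> words_meeting U n" for w
  proof -
    from w obtain x where x: "x \<in> dyadic_interval w" "x \<in> U" and len: "length w = n"
      unfolding words_meeting_def by blast
    have "dist x z \<le> 1 / 2 ^ n"
      using diameter_bounded_bound[OF assms(1) x(2) z] assms(2) by simp
    then have "\<bar>x * 2 ^ n - z * 2 ^ n\<bar> \<le> 1"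
      by (simp add: dist_real_def abs_le_iff field_simps)
    moreover have "dyadic_left w * 2 ^ n \<le> x * 2 ^ n" "x * 2 ^ n \<le> dyadic_left w * 2 ^ n + 1"
      using dyadic_interval_bounds[OF x(1)] len by (simp_all add: field_simps)
    ultimately have "real_of_int (f w) \<le> z * 2 ^ n + 1" "z * 2 ^ n - 2 \<le> real_of_int (f w)"
      unfolding fw[OF len] by linarith+
    then show ?thesis
      unfolding atLeastAtMost_iff by linarith
  qed
  then have "f ` words_meeting U n \<subseteq> {\<lfloor>z * 2 ^ n\<rfloor> - 2 .. \<lfloor>z * 2 ^ n\<rfloor> + 1}" by blast
  then have "card (f ` words_meeting U n) \<le> card {\<lfloor>z * 2 ^ n\<rfloor> - 2 .. \<lfloor>z * 2 ^ n\<rfloor> + 1}"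
    by (intro card_mono) auto
  then show ?thesis
    by (simp add: card_image[OF inj])
qed

lemma card_words_meeting_le:
  assumes "E \<subseteq> {0..1}"
  shows "card (words_meeting E n) \<le> 4 * covering_number (1 / 2 ^ n) E"
proof -
  obtain \<C> where \<C>: "finite \<C>" "card \<C> = covering_number (1 / 2 ^ n) E"
    "\<And>U. U \<in> \<C> \<Longrightarrow> bounded U \<and> diameter U \<le> 1 / 2 ^ n" "E \<subseteq> \<Union>\<C>"
    by (rule covering_number_attained[OF assms, of "1 / 2 ^ n"]) auto
  have "words_meeting E n \<subseteq> (\<Union>U\<in>\<C>. words_meeting U n)"
    using \<C>(4) unfolding words_meeting_def by blast
  then have "card (words_meeting E n) \<le> card (\<Union>U\<in>\<C>. words_meeting U n)"
    using \<C>(1) by (intro card_mono finite_UN_I finite_words_meeting)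
  also have "\<dots> \<le> (\<Sum>U\<in>\<C>. card (words_meeting U n))"
    by (rule card_UN_le[OF \<C>(1)])
  also have "\<dots> \<le> (\<Sum>U\<in>\<C>. 4)"
    using \<C>(3) by (intro sum_mono card_words_meeting_small) auto
  finally show ?thesis using \<C>(2) by simp
qed

lemma card_words_meeting_bound:
  assumes "E \<subseteq> {0..1}" "upper_box_dim E < ereal d"
  shows "eventually (\<lambda>n. real (card (words_meeting E n)) \<le> 4 * (2 powr d) ^ n) sequentially"
proof -
  have "filterlim (\<lambda>n. 1 / 2 ^ n :: real) (at_right 0) sequentially"
    by real_asymp
  from filterlim_iff[THEN iffD1, rule_format, OF this covering_number_powr_bound[OF assms(2)]]
  show ?thesis
  proof eventually_elim
    case (elim n)
    have "real (card (words_meeting E n)) \<le> real (4 * covering_number (1 / 2 ^ n) E)"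
      using card_words_meeting_le[OF assms(1)] by (intro of_nat_mono)
    also have "\<dots> \<le> 4 * (1 / 2 ^ n) powr (- d)"
      using elim by simp
    also have "(1 / 2 ^ n :: real) powr (- d) = (2 powr d) ^ n"
      by (simp add: powr_def ln_div ln_realpow exp_of_nat_mult[symmetric] mult_ac)
    finally show ?case .
  qed
qed

text \<open>Descending the dyadic tree from the root, every point of \<open>E\<close> leaves the finite set of words
  of weight exceeding \<open>r\<close>; the words at which this happens give the cover.\<close>
lemma covering_number_stopping:
  fixes f :: "real \<Rightarrow> real" and Z :: "bool list \<Rightarrow> real"
  assumes E: "E \<subseteq> {0..1}"
    and osc: "\<And>w x y. x \<in> dyadic_interval w \<Longrightarrow> y \<in> dyadic_interval w \<Longrightarrow> \<bar>f x - f y\<bar> \<le> Z w"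
    and S_def: "S = {w. dyadic_interval w \<inter> E \<noteq> {} \<and> r < Z w}"
    and fin: "finite S" and r: "0 < r"
  shows "covering_number r (f ` E) \<le> 1 + 2 * card S"
proof -
  \<comment> \<open>The first word of weight at most \<open>r\<close> on a branch is either the root
    or a child of a word in \<open>S\<close>; this is the origin of
    \<open>1 + 2 * card S\<close>.\<close>
  define T where "T = insert [] ((\<lambda>w. w @ [False]) ` S \<union> (\<lambda>w. w @ [True]) ` S)"
  define \<C> where "\<C> = (\<lambda>w. f ` (dyadic_interval w \<inter> E)) ` {w \<in> T. Z w \<le> r}"
  have finT: "finite T" unfolding T_def using fin by simp
  have "card T \<le> Suc (card ((\<lambda>w. w @ [False]) ` S \<union> (\<lambda>w. w @ [True]) ` S))"
    unfolding T_def using fin by (simp add: card_insert_if)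
  also have "\<dots> \<le> 1 + 2 * card S"
    using card_Un_le[of "(\<lambda>w. w @ [False]) ` S" "(\<lambda>w. w @ [True]) ` S"]
      card_image_le[OF fin, of "\<lambda>w. w @ [False]"] card_image_le[OF fin, of "\<lambda>w. w @ [True]"] by simp
  finally have cardT: "card T \<le> 1 + 2 * card S" .
  have "card \<C> \<le> card {w \<in> T. Z w \<le> r}"
    unfolding \<C>_def using finT by (intro card_image_le) auto
  also have "\<dots> \<le> card T"
    using finT by (intro card_mono) auto
  finally have card\<C>: "card \<C> \<le> 1 + 2 * card S" using cardT by simp
  have small: "bounded U \<and> diameter U \<le> r" if "U \<in> \<C>" for U
  proof -
    from that obtain w where U: "U = f ` (dyadic_interval w \<inter> E)" and w: "Z w \<le> r"
      unfolding \<C>_def by blast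
    have d: "dist a b \<le> r" if "a \<in> U" "b \<in> U" for a b
      using that osc[of _ w] w unfolding U dist_real_def by force
    then have "bounded U"
      unfolding bounded_two_points by blast
    moreover have "diameter U \<le> r"
      using d r by (intro diameter_le) (auto simp: dist_norm)
    ultimately show ?thesis by simp
  qed
  have "f x \<in> \<Union>\<C>" if x: "x \<in> E" for x
  proof (rule ccontr)
    assume nx: "f x \<notin> \<Union>\<C>"
    have in_S: "w \<in> S" if "w \<in> T" "x \<in> dyadic_interval w" for w
      using nx that x unfolding \<C>_def S_def by (auto simp: not_le)
    \<comment> \<open>If \<open>f x\<close> were not covered, a whole branch of words around
      \<open>x\<close> would stay in \<open>S\<close>, which would then contain words of every
      length.\<close>
    have "\<exists>w. length w = n \<and> x \<in> dyadic_interval w \<and> w \<in> S" for n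
    proof (induction n)
      case 0
      have "x \<in> dyadic_interval []" using E x by (auto simp: dyadic_interval_Nil)
      moreover have "[] \<in> T" by (simp add: T_def)
      ultimately show ?case using in_S by blast
    next
      case (Suc n)
      then obtain w where w: "length w = n" "x \<in> dyadic_interval w" "w \<in> S" by blast
      from dyadic_interval_children w(2) obtain b where b: "x \<in> dyadic_interval (w @ [b])" by blast
      have "w @ [b] \<in> T" using w(3) unfolding T_def by (cases b) auto
      then have "w @ [b] \<in> S" using b in_S by blast
      then show ?case using b w(1) by (intro exI[of _ "w @ [b]"]) auto
    qed
    then have "range (\<lambda>n::nat. n) \<subseteq> length ` S" by (auto simp: image_iff) metis
    then have "finite (range (\<lambda>n::nat. n))" using fin finite_surj by blast
    then show False by simp
  qed
  then have "f ` E \<subseteq> \<Union>\<C>" by blast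
  then have "covering_number r (f ` E) \<le> card \<C>"
    using small finT by (intro covering_number_le) (auto simp: \<C>_def)
  with card\<C> show ?thesis by simp
qed

text \<open>By Markov's inequality for counting measure, at most \<open>A / r powr s\<close> words have weight
  exceeding \<open>r\<close>.\<close>
lemma upper_box_dim_image_le:
  fixes f :: "real \<Rightarrow> real" and Z :: "bool list \<Rightarrow> real"
  assumes E: "E \<subseteq> {0..1}" and s: "0 < s"
    and osc: "\<And>w x y. x \<in> dyadic_interval w \<Longrightarrow> y \<in> dyadic_interval w \<Longrightarrow> \<bar>f x - f y\<bar> \<le> Z w"
    and sum: "(\<integral>\<^sup>+w. ennreal (Z w powr s) \<partial>count_space {w. dyadic_interval w \<inter> E \<noteq> {}}) < \<infinity>"
  shows "upper_box_dim (f ` E) \<le> ereal s"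
proof -
  define T where "T = {w. dyadic_interval w \<inter> E \<noteq> {}}"
  define A where "A = enn2real (\<integral>\<^sup>+w. ennreal (Z w powr s) \<partial>count_space T)"
  have A: "(\<integral>\<^sup>+w. ennreal (Z w powr s) \<partial>count_space T) = ennreal A" and A0: "0 \<le> A"
    using sum unfolding A_def T_def by simp_all
  have "real (covering_number r (f ` E)) \<le> (1 + 2 * A) * r powr (- s)" if r: "0 < r" "r < 1" for r
  proof -
    define S where "S = {w. dyadic_interval w \<inter> E \<noteq> {} \<and> r < Z w}"
    have "emeasure (count_space T) S \<le>
        emeasure (count_space T) ({w \<in> space (count_space T). 1 \<le> ennreal (r powr (- s)) * ennreal (Z w powr s)})"
    proof (rule emeasure_mono)
      show "S \<subseteq> {w \<in> space (count_space T). 1 \<le> ennreal (r powr (- s)) * ennreal (Z w powr s)}"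
      proof
        fix w assume w: "w \<in> S"
        then have "r powr s \<le> Z w powr s"
          unfolding S_def using r s by (intro powr_mono2) auto
        then have "1 \<le> r powr (- s) * Z w powr s"
          using r by (simp add: powr_minus field_simps)
        then show "w \<in> {w \<in> space (count_space T). 1 \<le> ennreal (r powr (- s)) * ennreal (Z w powr s)}"
          using w by (simp add: S_def T_def flip: ennreal_mult)
      qed
    qed simp
    also have "\<dots> \<le> ennreal (r powr (- s)) * (\<integral>\<^sup>+w. ennreal (Z w powr s) * indicator T w \<partial>count_space T)"
      using nn_integral_Markov_inequality[of "\<lambda>w. ennreal (Z w powr s)" T "count_space T" "ennreal (r powr (- s))"]
      by simp
    also have "(\<integral>\<^sup>+w. ennreal (Z w powr s) * indicator T w \<partial>count_space T) = ennreal A"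
      unfolding A[symmetric] by (intro nn_integral_cong) auto
    finally have em: "emeasure (count_space T) S \<le> ennreal (r powr (- s) * A)"
      using A0 by (simp add: ennreal_mult)
    have ST: "S \<subseteq> T" unfolding S_def T_def by blast
    \<comment> \<open>Finiteness of the set of heavy words is not known beforehand; it follows
      because an infinite set has infinite counting measure.\<close>
    have finS: "finite S"
      using em emeasure_count_space_infinite[OF ST] by (metis ennreal_neq_top infinity_ennreal_def top_unique)
    have "ennreal (real (card S)) \<le> ennreal (r powr (- s) * A)"
      using em by (simp add: emeasure_count_space_finite[OF ST finS] ennreal_of_nat_eq_real_of_nat)
    then have cS: "real (card S) \<le> r powr (- s) * A"
      using A0 by (simp add: ennreal_le_iff)
    have "1 \<le> r powr (- s)"
      using r s by (simp add: powr_minus powr_le1 one_le_inverse)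
    moreover have "covering_number r (f ` E) \<le> 1 + 2 * card S"
      using covering_number_stopping[OF E osc S_def finS r(1)] .
    then have "real (covering_number r (f ` E)) \<le> 1 + 2 * real (card S)"
      by linarith
    ultimately show ?thesis using cS by (simp add: algebra_simps)
  qed
  then show ?thesis
    using A0 s by (intro upper_box_dim_le[of "1 + 2 * A"]) auto
qed

subsection \<open>Almost harmonic functions for a centred random walk\<close>

text \<open>The tangent parabola at a minimum of \<open>u y + \<kappa> (y - R)\<^sup>2\<close>.\<close>
lemma lipschitz_mono_touching_parabola:
  fixes u :: "real \<Rightarrow> real"
  assumes mono: "mono u" and lip: "mono (\<lambda>y. y - u y)"
    and eps: "0 < \<epsilon>" and l: "0 < l" and jump: "\<epsilon> * l \<le> u R - u (R - l)"
  obtains y m where "R - 2 * l / \<epsilon> \<le> y" "\<epsilon>\<^sup>2 / 2 \<le> m" "m \<le> 2"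
    "\<And>x. m * x - \<epsilon> / (2 * l) * x\<^sup>2 \<le> u (y + x) - u y"
proof -
  \<comment> \<open>At distance \<open>l\<close> from \<open>R\<close> the penalty
    \<open>k * l * l\<close> equals \<open>\<epsilon> * l / 2\<close>, half of the assumed increment
    of \<open>u\<close>. So \<open>R - l\<close> beats \<open>R\<close> by a definite
    amount.\<close>
  define k where "k = \<epsilon> / (2 * l)"
  have k: "0 < k" "k * l = \<epsilon> / 2" "1 / k = 2 * l / \<epsilon>"
    unfolding k_def using eps l by (simp_all add: field_simps)
  define F where "F y = u y + k * (y - R)\<^sup>2" for y
  have lip': "u y - u x \<le> y - x" if "x \<le> y" for x y
    using monoD[OF lip that] by simp
  have mono': "u x \<le> u y" if "x \<le> y" for x y
    using monoD[OF mono that] .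
  have abs: "dist (u x) (u y) \<le> 1 * dist x y" for x y
    using lip'[of x y] lip'[of y x] mono'[of x y] mono'[of y x] by (simp add: dist_real_def) linarith
  have "1-lipschitz_on UNIV u"
    by (rule lipschitz_onI) (use abs in auto)
  then have cont_u: "continuous_on A u" for A
    using lipschitz_on_continuous_on lipschitz_on_subset by blast
  have "continuous_on {R - 1 / k .. R} F"
    unfolding F_def by (intro continuous_intros cont_u)
  moreover have "compact {R - 1 / k .. R}" "{R - 1 / k .. R} \<noteq> {}"
    using k by auto
  ultimately obtain y where y: "y \<in> {R - 1 / k .. R}" "\<And>x. x \<in> {R - 1 / k .. R} \<Longrightarrow> F y \<le> F x"
    using continuous_attains_inf by metis
  \<comment> \<open>The minimum over the window of width \<open>1 / k\<close> is global. To the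
    right of \<open>R\<close> both summands of \<open>F\<close> only exceed their values at
    \<open>R\<close>; to the left of the window the square outweighs the decrease of
    \<open>u\<close>, which is at most linear with slope 1.\<close>
  have ymin: "F y \<le> F x" for x
  proof -
    consider "x \<in> {R - 1 / k .. R}" | "R < x" | "x < R - 1 / k" by fastforce
    then show ?thesis
    proof cases
      case 2
      have "F y \<le> F R" using y(2)[of R] k(1) by simp
      also have "F R \<le> F x" unfolding F_def using mono'[of R x] 2 k(1) by (simp add: add_increasing2)
      finally show ?thesis .
    next
      case 3
      have kx: "1 \<le> k * (R - x)" using 3 k(1) by (simp add: field_simps)
      have pos: "0 \<le> R - x" using 3 k(1) by (smt (verit) divide_pos_pos)
      have "F y \<le> F R" using y(2)[of R] k(1) by simp
      also have "F R = u R" unfolding F_def by simp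
      also have "\<dots> \<le> u x + (R - x)" using lip'[of x R] pos by simp
      also have "R - x \<le> k * (R - x) * (R - x)"
        using mult_right_mono[OF kx pos] by simp
      also have "\<dots> = k * (x - R)\<^sup>2" by (simp add: power2_eq_square algebra_simps)
      finally show ?thesis unfolding F_def by simp
    qed (use y in auto)
  qed
  have "F y \<le> F (R - l)" by (rule ymin)
  also have "F (R - l) = u (R - l) + (k * l) * l"
    unfolding F_def by (simp add: power2_eq_square)
  also have "\<dots> \<le> u R - \<epsilon> * l / 2"
    unfolding k(2) using jump by simp
  finally have Fy: "F y \<le> u R - \<epsilon> * l / 2" .
  have yR: "y \<le> R" using y(1) by simp
  have "u R - (R - y) \<le> u y" using lip'[OF yR] by simp
  moreover have "0 \<le> k * (y - R)\<^sup>2" using k by simp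
  \<comment> \<open>Having slope at most 1, \<open>u\<close> can only drop by
    \<open>\<epsilon> * l / 2\<close> if \<open>y\<close> is at least that far from
    \<open>R\<close>. This keeps the slope \<open>m\<close> of the parabola away from 0.\<close>
  ultimately have gap: "\<epsilon> * l / 2 \<le> R - y" using Fy unfolding F_def by linarith
  define m where "m = 2 * k * (R - y)"
  show ?thesis
  proof (rule that[of y m])
    show "R - 2 * l / \<epsilon> \<le> y" using y(1) k(3) by simp
    have "\<epsilon>\<^sup>2 / 2 = 2 * k * (\<epsilon> * l / 2)"
      using k(2) by (simp add: power2_eq_square)
    also have "\<dots> \<le> m" unfolding m_def using gap k by (intro mult_left_mono) auto
    finally show "\<epsilon>\<^sup>2 / 2 \<le> m" .
    have "R - y \<le> 1 / k" using y(1) by simp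
    then show "m \<le> 2" unfolding m_def using k(1) by (simp add: field_simps)
    fix x
    have "F y \<le> F (y + x)" by (rule ymin)
    then show "m * x - \<epsilon> / (2 * l) * x\<^sup>2 \<le> u (y + x) - u y"
      unfolding F_def m_def k_def[symmetric] by (simp add: power2_eq_square algebra_simps)
  qed
qed

lemma sublinear_of_increments:
  fixes u :: "real \<Rightarrow> real"
  assumes mono: "mono u" and l: "0 < l" and eps: "0 < \<epsilon>"
    and step: "\<And>R. Y \<le> R \<Longrightarrow> u R - u (R - l) \<le> \<epsilon> * l"
  shows "\<exists>C. \<forall>y\<ge>0. u y \<le> \<epsilon> * y + C"
proof -
  define Y' where "Y' = max Y 0"
  have iter: "u (Y' + real n * l) \<le> u Y' + \<epsilon> * (real n * l)" for n
  proof (induction n)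
    case (Suc n)
    have "Y \<le> Y' + real (Suc n) * l" unfolding Y'_def using l by (smt (verit) mult_nonneg_nonneg of_nat_0_le_iff)
    from step[OF this] have "u (Y' + real (Suc n) * l) \<le> u (Y' + real n * l) + \<epsilon> * l"
      by (simp add: algebra_simps)
    with Suc show ?case by (simp add: algebra_simps)
  qed simp
  have "u y \<le> \<epsilon> * y + (\<bar>u Y'\<bar> + \<epsilon> * l)" if "0 \<le> y" for y
  proof -
    define n where "n = nat \<lceil>y / l\<rceil>"
    have "0 \<le> y / l" using that l by simp
    then have n: "y / l \<le> real n" "real n \<le> y / l + 1"
      unfolding n_def by linarith+
    then have n': "y \<le> real n * l" "real n * l \<le> y + l"
      using l by (simp_all add: field_simps)
    have "u y \<le> u (Y' + real n * l)"
      using n' by (intro monoD[OF mono]) (simp add: Y'_def)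
    also have "\<dots> \<le> u Y' + \<epsilon> * (real n * l)" by (rule iter)
    also have "\<epsilon> * (real n * l) \<le> \<epsilon> * (y + l)" using n' eps by (intro mult_left_mono) auto
    finally show ?thesis by (simp add: algebra_simps)
  qed
  then show ?thesis by blast
qed

text \<open>Under the measure with density \<open>W\<close>, the variable \<open>ln (2 / W)\<close>
  is centred. Were it nowhere positive, it would vanish, that is, \<open>W = 2\<close> almost
  surely. So it is positive on a set of positive weight, and the sets where it lies in
  \<open>[c, 1 / c]\<close> exhaust that set as \<open>c\<close> runs through
  \<open>1 / (n + 1)\<close>.\<close>

lemma (in prob_space) positive_log_part_nondegenerate:
  fixes W :: "'a \<Rightarrow> real"
  assumes [measurable]: "W \<in> borel_measurable M"
    and pos: "AE \<omega> in M. 0 < W \<omega>" and nonconst: "\<not> (AE \<omega> in M. W \<omega> = 2)"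
    and int: "integrable M W" "integrable M (\<lambda>\<omega>. W \<omega> * (ln 2 - ln (W \<omega>)))"
    and centred: "(\<integral>\<omega>. W \<omega> * (ln 2 - ln (W \<omega>)) \<partial>M) = 0"
  obtains c where "0 < c"
    "0 < (\<integral>\<omega>. W \<omega> * indicator {\<omega>. c \<le> ln 2 - ln (W \<omega>) \<and> ln 2 - ln (W \<omega>) \<le> 1 / c} \<omega> \<partial>M)"
proof (rule ccontr)
  assume no: "\<not> thesis"
  note choice = that
  define X where "X \<omega> = ln 2 - ln (W \<omega>)" for \<omega>
  define A where "A c = {\<omega>. c \<le> X \<omega> \<and> X \<omega> \<le> 1 / c}" for c
  have [measurable]: "X \<in> borel_measurable M" unfolding X_def by measurable
  have "AE \<omega> in M. \<omega> \<notin> A c" if c: "0 < c" for c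
  proof -
    have int': "integrable M (\<lambda>\<omega>. W \<omega> * indicator (A c) \<omega>)"
    proof (rule Bochner_Integration.integrable_bound[OF int(1)])
      show "(\<lambda>\<omega>. W \<omega> * indicator (A c) \<omega>) \<in> borel_measurable M"
        unfolding A_def indicator_def by measurable
      show "AE \<omega> in M. norm (W \<omega> * indicator (A c) \<omega>) \<le> norm (W \<omega>)"
        by (auto simp: indicator_def)
    qed
    have nn: "AE \<omega> in M. 0 \<le> W \<omega> * indicator (A c) \<omega>"
      using pos by eventually_elim auto
    have "\<not> 0 < (\<integral>\<omega>. W \<omega> * indicator (A c) \<omega> \<partial>M)"
      using no choice[OF c] unfolding A_def X_def by blast
    then have "(\<integral>\<omega>. W \<omega> * indicator (A c) \<omega> \<partial>M) = 0"
      using integral_nonneg_AE[OF nn] by linarith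
    then have "AE \<omega> in M. W \<omega> * indicator (A c) \<omega> = 0"
      using integral_nonneg_eq_0_iff_AE[OF int' nn] by simp
    with pos show ?thesis by eventually_elim (auto simp: indicator_def split: if_splits)
  qed
  then have "AE \<omega> in M. \<forall>n::nat. \<omega> \<notin> A (1 / real (Suc n))"
    by (subst AE_all_countable) auto
  then have nonpos: "AE \<omega> in M. X \<omega> \<le> 0"
  proof eventually_elim
    case (elim \<omega>)
    show ?case
    proof (rule ccontr)
      assume "\<not> X \<omega> \<le> 0"
      then have x: "0 < X \<omega>" by simp
      obtain n where n: "max (X \<omega>) (1 / X \<omega>) < real n" using reals_Archimedean2 by blast
      then have "1 / real (Suc n) \<le> X \<omega>" "X \<omega> \<le> real (Suc n)"
        using x by (auto simp: field_simps)
      then show False using elim[rule_format, of n] unfolding A_def by simp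
    qed
  qed
  have int2: "integrable M (\<lambda>\<omega>. - (W \<omega> * X \<omega>))" using int(2) unfolding X_def by simp
  have "AE \<omega> in M. 0 \<le> - (W \<omega> * X \<omega>)"
    using pos nonpos by eventually_elim (simp add: mult_le_0_iff)
  then have "AE \<omega> in M. - (W \<omega> * X \<omega>) = 0"
    using integral_nonneg_eq_0_iff_AE[OF int2] centred unfolding X_def by simp
  with pos have "AE \<omega> in M. W \<omega> = 2"
    by eventually_elim (auto simp: X_def)
  with nonconst show False by blast
qed

text \<open>In the variable \<open>y = - ln t\<close>, the function \<open>g t / t\<close> is almost harmonic for a centred random
  walk with finite variance. A positive slope of \<open>u = ln (g t / t)\<close> at a point of contact with a
  flat parabola would contradict this by the strict convexity of the exponential function.\<close>
lemma (in prob_space) smoothing_fixed_point_growth: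
  fixes W :: "'a \<Rightarrow> real" and g :: "real \<Rightarrow> real"
  assumes W [measurable]: "W \<in> borel_measurable M"
    and pos: "AE \<omega> in M. 0 < W \<omega>" and nonconst: "\<not> (AE \<omega> in M. W \<omega> = 2)"
    and int1: "integrable M W" and EW: "(\<integral>\<omega>. W \<omega> \<partial>M) = 1"
    and int2: "integrable M (\<lambda>\<omega>. W \<omega> * ln (W \<omega>))" and crit: "(\<integral>\<omega>. W \<omega> * ln (W \<omega>) \<partial>M) = ln 2"
    and int3: "integrable M (\<lambda>\<omega>. W \<omega> * (ln (W \<omega>))\<^sup>2)"
    and g [measurable]: "g \<in> borel_measurable borel"
    and gpos: "\<And>t. 0 < t \<Longrightarrow> 0 < g t" and gle: "\<And>t. 0 < t \<Longrightarrow> g t \<le> 1"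
    and gmono: "\<And>s t. 0 < s \<Longrightarrow> s \<le> t \<Longrightarrow> g s \<le> g t"
    and gdiv: "\<And>s t. 0 < s \<Longrightarrow> s \<le> t \<Longrightarrow> g t / t \<le> g s / s"
    and glim: "(g \<longlongrightarrow> 0) (at_right 0)"
    and fixpt: "\<And>t. 0 < t \<Longrightarrow>
      g t = (\<integral>\<omega>. g (t * W \<omega> / 2) \<partial>M) * (2 - (\<integral>\<omega>. g (t * W \<omega> / 2) \<partial>M))"
    and eps: "0 < \<epsilon>"
  shows "\<exists>C. \<forall>t. 0 < t \<and> t \<le> 1 \<longrightarrow> g t \<le> C * t powr (1 - \<epsilon>)"
proof -
  define q where "q t = (\<integral>\<omega>. g (t * W \<omega> / 2) \<partial>M)" for t
  \<comment> \<open>The step of the walk: replacing \<open>t\<close> by \<open>t * W / 2\<close>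
    moves \<open>y = - ln t\<close> to \<open>y + X\<close>. The law of the step is taken with
    density \<open>W\<close>, under which it has mean 0 and variance
    \<open>\<sigma>\<close>.\<close>
  define X where "X \<omega> = ln 2 - ln (W \<omega>)" for \<omega>
  define u where "u y = ln (g (exp (- y))) + y" for y
  have [measurable]: "X \<in> borel_measurable M" unfolding X_def by measurable
  have intWX: "integrable M (\<lambda>\<omega>. W \<omega> * X \<omega>)"
    unfolding X_def right_diff_distrib using int1 int2 by simp
  have EWX: "(\<integral>\<omega>. W \<omega> * X \<omega> \<partial>M) = 0"
    unfolding X_def right_diff_distrib using int1 int2 EW crit by simp
  have WX2: "W \<omega> * (X \<omega>)\<^sup>2 = (ln 2)\<^sup>2 * W \<omega> - 2 * ln 2 * (W \<omega> * ln (W \<omega>)) + W \<omega> * (ln (W \<omega>))\<^sup>2" for \<omega>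
    unfolding X_def by (simp add: power2_eq_square algebra_simps)
  have intWX2: "integrable M (\<lambda>\<omega>. W \<omega> * (X \<omega>)\<^sup>2)"
    unfolding WX2 using int1 int2 int3 by simp
  define \<sigma> where "\<sigma> = (\<integral>\<omega>. W \<omega> * (X \<omega>)\<^sup>2 \<partial>M)"
  have sigma0: "0 \<le> \<sigma>"
    unfolding \<sigma>_def using pos by (intro integral_nonneg_AE) (auto elim!: eventually_mono)
  obtain c where c: "0 < c" and "0 < (\<integral>\<omega>. W \<omega> * indicator {\<omega>. c \<le> X \<omega> \<and> X \<omega> \<le> 1 / c} \<omega> \<partial>M)"
    by (rule positive_log_part_nondegenerate[OF W pos nonconst int1 intWX[unfolded X_def]
          EWX[unfolded X_def], folded X_def])
  define A where "A = {\<omega>. c \<le> X \<omega> \<and> X \<omega> \<le> 1 / c}"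
  define p where "p = (\<integral>\<omega>. W \<omega> * indicator A \<omega> \<partial>M)"
  have p: "0 < p" unfolding p_def A_def by fact
  have intA: "integrable M (\<lambda>\<omega>. W \<omega> * indicator A \<omega>)"
  proof (rule Bochner_Integration.integrable_bound[OF int1])
    show "(\<lambda>\<omega>. W \<omega> * indicator A \<omega>) \<in> borel_measurable M"
      unfolding A_def indicator_def by measurable
    show "AE \<omega> in M. norm (W \<omega> * indicator A \<omega>) \<le> norm (W \<omega>)"
      by (auto simp: indicator_def)
  qed
  have intg: "integrable M (\<lambda>\<omega>. g (t * W \<omega> / 2))" if t: "0 < t" for t
  proof (rule integrable_const_bound[where B = 1])
    show "AE \<omega> in M. norm (g (t * W \<omega> / 2)) \<le> 1"
      using pos
    proof eventually_elim
      case (elim \<omega>)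
      then show ?case using t gpos[of "t * W \<omega> / 2"] gle[of "t * W \<omega> / 2"] by simp
    qed
  qed measurable
  have q01: "0 \<le> q t \<and> q t \<le> 1" if t: "0 < t" for t
  proof
    show "0 \<le> q t"
      unfolding q_def using pos
      by (intro integral_nonneg_AE) (auto elim!: eventually_mono intro!: less_imp_le gpos simp: t)
    have "q t \<le> (\<integral>\<omega>. 1 \<partial>M)"
      unfolding q_def using pos
      by (intro integral_mono_AE intg t) (auto elim!: eventually_mono intro!: gle simp: t)
    then show "q t \<le> 1" by (simp add: prob_space)
  qed
  have qg: "q t \<le> g t" if t: "0 < t" for t
  proof -
    have "q t * 1 \<le> q t * (2 - q t)"
      using q01[OF t] by (intro mult_left_mono) auto
    then show ?thesis using fixpt[OF t, folded q_def] by simp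
  qed
  \<comment> \<open>Monotonicity of \<open>g t / t\<close> and of \<open>g\<close> say that the
    slopes of \<open>u\<close> lie between 0 and 1, as the touching parabola requires.\<close>
  have umono: "mono u"
  proof (rule monoI)
    fix x y :: real assume "x \<le> y"
    then have "g (exp (- x)) / exp (- x) \<le> g (exp (- y)) / exp (- y)"
      by (intro gdiv) auto
    then have "ln (g (exp (- x)) / exp (- x)) \<le> ln (g (exp (- y)) / exp (- y))"
      by (intro ln_mono divide_pos_pos gpos) auto
    then show "u x \<le> u y"
      unfolding u_def using gpos[of "exp (- x)"] gpos[of "exp (- y)"] by (simp add: ln_div)
  qed
  have ulip: "mono (\<lambda>y. y - u y)"
  proof (rule monoI)
    fix x y :: real assume "x \<le> y"
    then have "ln (g (exp (- y))) \<le> ln (g (exp (- x)))"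
      using \<open>x \<le> y\<close> by (intro ln_mono gpos gmono) auto
    then show "x - u x \<le> y - u y" unfolding u_def by simp
  qed
  define m0 where "m0 = \<epsilon>\<^sup>2 / 2"
  have m0: "0 < m0" unfolding m0_def using eps by simp
  \<comment> \<open>On \<open>A\<close> the second-order term of the exponential contributes
    \<open>p * (c * m0)\<^sup>2 / 8\<close>, which is \<open>2 * \<eta>\<close>. The curvature
    \<open>k\<close> is so small that its cost \<open>k * \<sigma>\<close> uses at most half of this
    gain, and that on \<open>A\<close> the parabola keeps at least half of its slope.\<close>
  define \<eta> where "\<eta> = p * (c * m0)\<^sup>2 / 16"
  have eta: "0 < \<eta>" unfolding \<eta>_def using p c m0 by simp
  define k where "k = min (c * m0 / 2) (\<eta> / (\<sigma> + 1))"
  have k: "0 < k" unfolding k_def using c m0 eta sigma0 by simp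
  have k1: "k \<le> c * m0 / 2" unfolding k_def by (rule min.cobounded1)
  have "k * \<sigma> \<le> k * (\<sigma> + 1)" using k by simp
  also have "\<dots> \<le> \<eta> / (\<sigma> + 1) * (\<sigma> + 1)"
    using sigma0 unfolding k_def by (intro mult_right_mono min.cobounded2) auto
  also have "\<dots> = \<eta>" using sigma0 by simp
  finally have k2: "k * \<sigma> \<le> \<eta>" .
  define l where "l = \<epsilon> / (2 * k)"
  have l: "0 < l" "\<epsilon> / (2 * l) = k" unfolding l_def using eps k by simp_all
  \<comment> \<open>The fixed-point equation is linear up to the factor \<open>2 - q t\<close>. The
    threshold \<open>2 * \<eta> / (1 + \<eta>)\<close> is the value of \<open>q t\<close> at which
    \<open>(1 + \<eta>) * (2 - q t)\<close> equals 2.\<close>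
  have "((\<lambda>y. g (exp (- y))) \<longlongrightarrow> 0) at_top"
    by (rule filterlim_compose[OF glim]) real_asymp
  moreover have "0 < 2 * \<eta> / (1 + \<eta>)" using eta by simp
  ultimately have "eventually (\<lambda>y. g (exp (- y)) < 2 * \<eta> / (1 + \<eta>)) at_top"
    by (simp add: order_tendsto_iff)
  then obtain Y where Y: "\<And>y. Y \<le> y \<Longrightarrow> g (exp (- y)) < 2 * \<eta> / (1 + \<eta>)"
    unfolding eventually_at_top_linorder by blast
  have "u R - u (R - l) \<le> \<epsilon> * l" if R: "Y + 2 * l / \<epsilon> \<le> R" for R
  proof (rule ccontr)
    assume "\<not> u R - u (R - l) \<le> \<epsilon> * l"
    then have "\<epsilon> * l \<le> u R - u (R - l)" by simp
    from lipschitz_mono_touching_parabola[OF umono ulip eps l(1) this]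
    obtain y m where y: "R - 2 * l / \<epsilon> \<le> y" and m: "m0 \<le> m"
      and touch: "\<And>x. m * x - k * x\<^sup>2 \<le> u (y + x) - u y"
      unfolding l(2) m0_def by metis
    define t where "t = exp (- y)"
    have t: "0 < t" unfolding t_def by simp
    have "q t < 2 * \<eta> / (1 + \<eta>)"
      using Y[of y] y R qg[OF t] unfolding t_def by linarith
    then have small: "2 < (1 + \<eta>) * (2 - q t)" using eta by (simp add: field_simps)
    \<comment> \<open>The touching parabola bounds \<open>g (t * W / 2) / g t\<close> from below by
      an exponential, which is expanded to second order on \<open>A\<close> and to first order
      elsewhere. On integration the linear term \<open>m * (W * X)\<close> drops out since the walk
      is centred.\<close>
    have "AE \<omega> in M. W \<omega> + m * (W \<omega> * X \<omega>) - k * (W \<omega> * (X \<omega>)\<^sup>2) + (c * m0)\<^sup>2 / 8 * (W \<omega> * indicator A \<omega>)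
        \<le> 2 / g t * g (t * W \<omega> / 2)"
      using pos
    proof eventually_elim
      case (elim \<omega>)
      define z where "z = m * X \<omega> - k * (X \<omega>)\<^sup>2"
      have "exp (- (y + X \<omega>)) = t * W \<omega> / 2"
        unfolding t_def X_def using elim by (simp add: exp_diff algebra_simps exp_add) (simp add: exp_minus field_simps)
      then have "exp (u (y + X \<omega>) - u y) = g (t * W \<omega> / 2) / g t * exp (X \<omega>)"
        using gpos[OF t] gpos[of "t * W \<omega> / 2"] t elim
        unfolding u_def t_def[symmetric] by (simp only: exp_diff exp_add exp_ln) simp
      also have "exp (X \<omega>) = 2 / W \<omega>"
        unfolding X_def using elim by (simp add: exp_diff)
      finally have "W \<omega> * exp (u (y + X \<omega>) - u y) = 2 / g t * g (t * W \<omega> / 2)"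
        using elim by simp
      moreover have "exp z \<le> exp (u (y + X \<omega>) - u y)"
        unfolding z_def using touch by simp
      ultimately have *: "W \<omega> * exp z \<le> 2 / g t * g (t * W \<omega> / 2)"
        using elim by (metis mult_left_mono less_imp_le)
      have "1 + z + (c * m0)\<^sup>2 / 8 * indicator A \<omega> \<le> exp z"
      proof (cases "\<omega> \<in> A")
        case True
        then have x: "c \<le> X \<omega>" "X \<omega> \<le> 1 / c" unfolding A_def by auto
        have "k * X \<omega> \<le> c * m0 / 2 * (1 / c)"
          using k1 x k c m0 by (intro mult_mono) auto
        also have "\<dots> = m0 / 2" using c by simp
        finally have mk: "m0 / 2 \<le> m - k * X \<omega>" using m by linarith
        have "c * (m0 / 2) \<le> X \<omega> * (m - k * X \<omega>)"
          by (rule mult_mono) (use mk x(1) c m0 in linarith)+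
        also have "\<dots> = z" unfolding z_def power2_eq_square by algebra
        finally have z: "c * m0 / 2 \<le> z" by simp
        then have "(c * m0 / 2)\<^sup>2 \<le> z\<^sup>2" using c m0 by (intro power_mono) auto
        moreover have "0 < c * m0 / 2" using c m0 by simp
        then have "0 \<le> z" using z by linarith
        then have "1 + z + z\<^sup>2 / 2 \<le> exp z" by (rule exp_lower_Taylor_quadratic)
        ultimately show ?thesis using True by (simp add: power_divide)
      next
        case False
        then show ?thesis using exp_ge_add_one_self[of z] by simp
      qed
      then have "W \<omega> * (1 + z + (c * m0)\<^sup>2 / 8 * indicator A \<omega>) \<le> W \<omega> * exp z"
        using elim by (intro mult_left_mono) auto
      with * show ?case unfolding z_def by (simp add: algebra_simps)
    qed
    then have "(\<integral>\<omega>. W \<omega> + m * (W \<omega> * X \<omega>) - k * (W \<omega> * (X \<omega>)\<^sup>2) + (c * m0)\<^sup>2 / 8 * (W \<omega> * indicator A \<omega>) \<partial>M)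
        \<le> (\<integral>\<omega>. 2 / g t * g (t * W \<omega> / 2) \<partial>M)"
      using int1 intWX intWX2 intA intg[OF t] by (intro integral_mono_AE) simp_all
    also have "(\<integral>\<omega>. 2 / g t * g (t * W \<omega> / 2) \<partial>M) = 2 / g t * q t"
      unfolding q_def by simp
    also have "(\<integral>\<omega>. W \<omega> + m * (W \<omega> * X \<omega>) - k * (W \<omega> * (X \<omega>)\<^sup>2) + (c * m0)\<^sup>2 / 8 * (W \<omega> * indicator A \<omega>) \<partial>M)
        = 1 - k * \<sigma> + 2 * \<eta>"
      using int1 intWX intWX2 intA EW EWX unfolding \<sigma>_def \<eta>_def p_def by simp
    \<comment> \<open>By the fixed-point equation the right-hand side is
      \<open>2 / (2 - q t)\<close>, and for small \<open>q t\<close> this is less than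
      \<open>1 + \<eta>\<close>.\<close>
    finally have "1 + \<eta> \<le> 2 * q t / g t" using k2 by simp
    then have "(1 + \<eta>) * (q t * (2 - q t)) \<le> 2 * q t"
      using gpos[OF t] fixpt[OF t] unfolding q_def[symmetric] by (simp add: field_simps)
    moreover have "0 < q t"
      using gpos[OF t] fixpt[OF t] q01[OF t] unfolding q_def[symmetric] by (simp add: zero_less_mult_iff)
    ultimately have "(1 + \<eta>) * (2 - q t) \<le> 2"
      by (simp add: mult.left_commute mult.commute[of 2])
    with small show False by simp
  qed
  from sublinear_of_increments[OF umono l(1) eps this]
  obtain C where C: "\<And>y. 0 \<le> y \<Longrightarrow> u y \<le> \<epsilon> * y + C" by blast
  have "g t \<le> exp C * t powr (1 - \<epsilon>)" if t: "0 < t" "t \<le> 1" for t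
  proof -
    have "ln (g t) \<le> C + (1 - \<epsilon>) * ln t"
      using C[of "- ln t"] t unfolding u_def by (simp add: algebra_simps)
    then have "exp (ln (g t)) \<le> exp (C + (1 - \<epsilon>) * ln t)" by simp
    then show ?thesis
      using gpos[OF t(1)] t by (simp add: exp_add powr_def)
  qed
  then show ?thesis by blast
qed

subsection \<open>Independence in the cascade\<close>

lemma powr_le_one_plus:
  fixes x s :: real
  assumes "0 \<le> x" "0 \<le> s" "s \<le> 1"
  shows "x powr s \<le> 1 + x"
proof (cases "x \<le> 1")
  case True
  then show ?thesis using assms powr_le1[of s x] by simp
next
  case False
  then show ?thesis using powr_mono[of s 1 x] assms by simp
qed

text \<open>Fubini's theorem for the product law: the first variable is frozen while the second is
  averaged.\<close>

lemma (in prob_space) expectation_indep_var_bounded: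
  fixes h :: "real \<times> real \<Rightarrow> real"
  assumes ind: "indep_var borel X borel Y"
    and h [measurable]: "h \<in> borel_measurable (borel \<Otimes>\<^sub>M borel)" and B: "\<And>z. \<bar>h z\<bar> \<le> B"
  shows "(\<integral>\<omega>. h (X \<omega>, Y \<omega>) \<partial>M) = (\<integral>\<omega>. (\<integral>\<omega>'. h (X \<omega>, Y \<omega>') \<partial>M) \<partial>M)"
proof -
  have [measurable]: "random_variable borel X" "random_variable borel Y"
    using ind indep_var_rv1 indep_var_rv2 by blast+
  interpret X: prob_space "distr M borel X" by (rule prob_space_distr) simp
  interpret Y: prob_space "distr M borel Y" by (rule prob_space_distr) simp
  interpret XY: pair_prob_space "distr M borel X" "distr M borel Y" by standard
  have int: "integrable (distr M borel X \<Otimes>\<^sub>M distr M borel Y) h"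
    by (rule XY.integrable_const_bound[where B = B]) (use B in simp_all)
  have "(\<integral>\<omega>. h (X \<omega>, Y \<omega>) \<partial>M) = (\<integral>z. h z \<partial>distr M (borel \<Otimes>\<^sub>M borel) (\<lambda>\<omega>. (X \<omega>, Y \<omega>)))"
    by (simp add: integral_distr)
  also have "\<dots> = (\<integral>z. h z \<partial>(distr M borel X \<Otimes>\<^sub>M distr M borel Y))"
    using ind unfolding indep_var_distribution_eq by simp
  also have "\<dots> = (\<integral>x. (\<integral>y. h (x, y) \<partial>distr M borel Y) \<partial>distr M borel X)"
    using XY.integral_fst'[OF int] by simp
  also have "\<dots> = (\<integral>\<omega>. (\<integral>\<omega>'. h (X \<omega>, Y \<omega>') \<partial>M) \<partial>M)"
    by (simp add: integral_distr)
  finally show ?thesis .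
qed

text \<open>A cascade sum or product is a function of the weights below its root. The function is the
  same sum or product formed with the coordinate projections in place of the weights.\<close>
definition descendants :: "bool list \<Rightarrow> bool list set" where
  "descendants u = {u @ v |v. v \<noteq> []}"

abbreviation coord :: "bool list \<Rightarrow> (bool list \<Rightarrow> real) \<Rightarrow> real" where
  "coord w f \<equiv> f w"

lemma append_take_in_descendants: "k \<in> {1..length w} \<Longrightarrow> u @ take k w \<in> descendants u"
  unfolding descendants_def by (cases w) auto

lemma measurable_cascade_prod_coord:
  assumes "descendants u \<subseteq> D"
  shows "cascade_prod coord u w \<in> borel_measurable (PiM D (\<lambda>_. borel))"
  unfolding cascade_prod_def using assms
  by (intro borel_measurable_prod measurable_component_singleton) (use append_take_in_descendants in blast)

lemma measurable_cascade_sum_coord: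
  assumes "descendants u \<subseteq> D"
  shows "cascade_sum coord u n \<in> borel_measurable (PiM D (\<lambda>_. borel))"
  unfolding cascade_sum_def
  by (intro borel_measurable_sum borel_measurable_divide measurable_cascade_prod_coord assms) auto

lemma cascade_prod_coord_restrict:
  assumes "descendants u \<subseteq> D"
  shows "cascade_prod coord u w (\<lambda>v\<in>D. V v \<omega>) = cascade_prod V u w \<omega>"
proof -
  have "u @ take k w \<in> D" if "k \<in> {1..length w}" for k
    using assms append_take_in_descendants[OF that] by blast
  then show ?thesis unfolding cascade_prod_def by (intro prod.cong) auto
qed

lemma cascade_sum_coord_restrict:
  assumes "descendants u \<subseteq> D"
  shows "cascade_sum coord u n (\<lambda>v\<in>D. V v \<omega>) = cascade_sum V u n \<omega>"
  unfolding cascade_sum_def cascade_prod_coord_restrict[OF assms] ..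

lemma cascade_prod_Nil [simp]: "cascade_prod V u [] \<omega> = 1"
  by (simp add: cascade_prod_def)

lemma cascade_prod_Cons:
  "cascade_prod V u (b # w) \<omega> = V (u @ [b]) \<omega> * cascade_prod V (u @ [b]) w \<omega>"
proof -
  have "cascade_prod V u (b # w) \<omega> = (\<Prod>k\<in>{1..Suc (length w)}. V (u @ take k (b # w)) \<omega>)"
    by (simp add: cascade_prod_def)
  also have "\<dots> = V (u @ [b]) \<omega> * (\<Prod>k\<in>{2..Suc (length w)}. V (u @ take k (b # w)) \<omega>)"
    by (subst prod.atLeast_Suc_atMost) (auto simp: numeral_2_eq_2)
  also have "(\<Prod>k\<in>{2..Suc (length w)}. V (u @ take k (b # w)) \<omega>)
      = (\<Prod>k\<in>{1..length w}. V (u @ take (Suc k) (b # w)) \<omega>)"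
    using prod.shift_bounds_cl_Suc_ivl[of "\<lambda>k. V (u @ take k (b # w)) \<omega>" 1 "length w"]
    by (simp add: numeral_2_eq_2)
  finally show ?thesis by (simp add: cascade_prod_def)
qed

lemma words_Suc:
  "{w :: bool list. length w = Suc n} = (#) False ` {w. length w = n} \<union> (#) True ` {w. length w = n}"
  by (auto simp: length_Suc_conv)

lemma cascade_sum_0 [simp]: "cascade_sum V u 0 \<omega> = 1"
  by (simp add: cascade_sum_def)

text \<open>This branching identity is the source of the recursion for
  \<open>cascade_laplace\<close>.\<close>

lemma cascade_sum_Suc:
  "cascade_sum V u (Suc n) \<omega> =
    (V (u @ [False]) \<omega> * cascade_sum V (u @ [False]) n \<omega>
      + V (u @ [True]) \<omega> * cascade_sum V (u @ [True]) n \<omega>) / 2"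
proof -
  have *: "(\<Sum>w\<in>(#) b ` {w. length w = n}. cascade_prod V u w \<omega> / 2 ^ Suc n)
      = V (u @ [b]) \<omega> * cascade_sum V (u @ [b]) n \<omega> / 2" for b
    by (subst sum.reindex)
      (auto simp: cascade_prod_Cons cascade_sum_def sum_distrib_left sum_divide_distrib intro!: sum.cong)
  show ?thesis
    unfolding cascade_sum_def[of V u "Suc n"] words_Suc
    by (subst sum.union_disjoint) (auto simp: * finite_words add_divide_distrib simp del: power_Suc)
qed

section \<open>Positivity, independence and moments of the weights along a path\<close>

locale cascade_model = prob_space M for M :: "'a measure" +
  fixes W :: "'a \<Rightarrow> real" and V :: "bool list \<Rightarrow> 'a \<Rightarrow> real"
  assumes generator: "cascade_generator M W" and weights: "cascade_weights M W V"
begin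

lemma W_measurable [measurable]: "W \<in> borel_measurable M"
  and W_pos: "AE \<omega> in M. 0 < W \<omega>"
  and W_nonconst: "\<not> (AE \<omega> in M. W \<omega> = c)"
  and W_integrable: "integrable M W"
  and W_mean: "(\<integral>\<omega>. W \<omega> \<partial>M) = 1"
  using generator unfolding cascade_generator_def by auto

lemma V_indep: "indep_vars (\<lambda>_. borel) V {w. w \<noteq> []}"
  and V_distr: "w \<noteq> [] \<Longrightarrow> distr M borel (V w) = distr M borel W"
  using weights unfolding cascade_weights_def by auto

lemma V_measurable: "w \<noteq> [] \<Longrightarrow> V w \<in> borel_measurable M"
  using V_indep unfolding indep_vars_def by auto

lemma V_pos: "AE \<omega> in M. \<forall>w. w \<noteq> [] \<longrightarrow> 0 < V w \<omega>"
proof -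
  have "AE \<omega> in M. 0 < V w \<omega>" if w: "w \<noteq> []" for w
  proof -
    have "AE x in distr M borel W. 0 < x"
      by (subst AE_distr_iff) (use W_pos in auto)
    then have "AE x in distr M borel (V w). 0 < x"
      unfolding V_distr[OF w] .
    then show ?thesis
      by (subst (asm) AE_distr_iff) (use V_measurable[OF w] in auto)
  qed
  then show ?thesis
    by (subst AE_all_countable) auto
qed

lemma nn_integral_V:
  assumes "w \<noteq> []" and [measurable]: "f \<in> borel_measurable borel"
  shows "(\<integral>\<^sup>+\<omega>. f (V w \<omega>) \<partial>M) = (\<integral>\<^sup>+\<omega>. f (W \<omega>) \<partial>M)"
  using nn_integral_distr[of "V w" M borel f] nn_integral_distr[of W M borel f] assms V_distr[of w]
    V_measurable[of w] by simp

lemma integral_V: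
  fixes f :: "real \<Rightarrow> real"
  assumes "w \<noteq> []" and [measurable]: "f \<in> borel_measurable borel"
  shows "(\<integral>\<omega>. f (V w \<omega>) \<partial>M) = (\<integral>\<omega>. f (W \<omega>) \<partial>M)"
  using integral_distr[of "V w" M borel f] integral_distr[of W M borel f] assms V_distr[of w]
    V_measurable[of w] by simp

lemma cascade_prod_measurable [measurable]: "cascade_prod V u w \<in> borel_measurable M"
  unfolding cascade_prod_def by (intro borel_measurable_prod V_measurable) auto

lemma cascade_sum_measurable [measurable]: "cascade_sum V u n \<in> borel_measurable M"
  unfolding cascade_sum_def by measurable

lemma cascade_prod_pos:
  assumes "\<forall>w. w \<noteq> [] \<longrightarrow> 0 < V w \<omega>"
  shows "0 < cascade_prod V u w \<omega>"
  unfolding cascade_prod_def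
proof (intro prod_pos)
  fix k assume "k \<in> {1..length w}"
  then have "u @ take k w \<noteq> []" by (cases w) auto
  then show "0 < V (u @ take k w) \<omega>" using assms by blast
qed

lemma cascade_sum_nonneg:
  assumes "\<forall>w. w \<noteq> [] \<longrightarrow> 0 < V w \<omega>"
  shows "0 \<le> cascade_sum V u n \<omega>"
  unfolding cascade_sum_def using cascade_prod_pos[OF assms]
  by (intro sum_nonneg divide_nonneg_nonneg) (auto intro: less_imp_le)

lemma W_powr_integrable:
  assumes "0 \<le> s" "s \<le> 1"
  shows "integrable M (\<lambda>\<omega>. W \<omega> powr s)"
proof (rule Bochner_Integration.integrable_bound)
  show "integrable M (\<lambda>\<omega>. 1 + W \<omega>)" using W_integrable by simp
  show "AE \<omega> in M. norm (W \<omega> powr s) \<le> norm (1 + W \<omega>)"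
    using W_pos
  proof eventually_elim
    case (elim \<omega>)
    then show ?case using powr_le_one_plus[of "W \<omega>" s] assms by simp
  qed
qed measurable

lemma W_powr_pos:
  assumes "0 \<le> s" "s \<le> 1"
  shows "0 < (\<integral>\<omega>. W \<omega> powr s \<partial>M)"
proof -
  have nn: "AE \<omega> in M. 0 \<le> W \<omega> powr s" by simp
  have "(\<integral>\<omega>. W \<omega> powr s \<partial>M) \<noteq> 0"
  proof
    assume "(\<integral>\<omega>. W \<omega> powr s \<partial>M) = 0"
    then have "AE \<omega> in M. W \<omega> powr s = 0"
      using integral_nonneg_eq_0_iff_AE[OF W_powr_integrable[OF assms] nn] by simp
    with W_pos have "AE \<omega> in M. False" by eventually_elim auto
    then show False by simp
  qed
  then show ?thesis using integral_nonneg_AE[OF nn] by linarith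
qed

text \<open>The weights on the path from \<open>u\<close> to \<open>u @ w\<close> and those strictly
  below \<open>u @ w\<close> are disjoint families, so the expectation factorises. The sum has a
  finite stage \<open>m\<close> because it must be a function of the weights; limits are taken
  later.\<close>

lemma nn_integral_cascade_prod:
  fixes F :: "real \<Rightarrow> real"
  assumes s: "0 \<le> s" "s \<le> 1" and F [measurable]: "F \<in> borel_measurable borel" and F0: "\<And>x. 0 \<le> F x"
  shows "(\<integral>\<^sup>+\<omega>. ennreal (cascade_prod V u w \<omega> powr s * F (cascade_sum V (u @ w) m \<omega>)) \<partial>M)
    = ennreal ((\<integral>\<omega>. W \<omega> powr s \<partial>M) ^ length w)
      * (\<integral>\<^sup>+\<omega>. ennreal (F (cascade_sum V (u @ w) m \<omega>)) \<partial>M)"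
proof -
  let ?n = "length w"
  \<comment> \<open>Block 0 holds the weights strictly below \<open>u @ w\<close>; block
    \<open>j > 0\<close> holds the single weight at the \<open>j\<close>-th vertex of the
    path.\<close>
  define K where "K j = (if j = 0 then descendants (u @ w) else {u @ take j w})" for j
  define G :: "nat \<Rightarrow> (bool list \<Rightarrow> real) \<Rightarrow> real" where
    "G j f = (if j = 0 then F (cascade_sum coord (u @ w) m f) else f (u @ take j w) powr s)" for j f
  define Z where "Z j \<omega> = G j (\<lambda>v\<in>K j. V v \<omega>)" for j \<omega>
  have Z0: "Z 0 \<omega> = F (cascade_sum V (u @ w) m \<omega>)" for \<omega>
    unfolding Z_def G_def K_def by (simp add: cascade_sum_coord_restrict)
  have ZS: "Z j \<omega> = V (u @ take j w) \<omega> powr s" if "j \<in> {1..?n}" for j \<omega>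
    using that unfolding Z_def G_def K_def by auto
  have disj: "disjoint_family_on K {..?n}"
    unfolding disjoint_family_on_def K_def descendants_def
    by (auto simp: min_def dest!: arg_cong[of _ _ length] split: if_splits)
  have "indep_vars (\<lambda>j. PiM (K j) (\<lambda>_. borel)) (\<lambda>j \<omega>. \<lambda>v\<in>K j. V v \<omega>) {..?n}"
    by (rule indep_vars_restrict[OF V_indep _ disj]) (auto simp: K_def descendants_def)
  then have ind: "indep_vars (\<lambda>_. borel) Z {..?n}"
    unfolding Z_def
  proof (rule indep_vars_compose2)
    fix j
    show "G j \<in> borel_measurable (PiM (K j) (\<lambda>_. borel))"
    proof (cases "j = 0")
      case True
      then have "G j = (\<lambda>f. F (cascade_sum coord (u @ w) m f))" by (auto simp: G_def)
      moreover have "descendants (u @ w) \<subseteq> K j" using True by (simp add: K_def)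
      note [measurable] = measurable_cascade_sum_coord[OF this]
      have "(\<lambda>f. F (cascade_sum coord (u @ w) m f)) \<in> borel_measurable (PiM (K j) (\<lambda>_. borel))"
        by measurable
      ultimately show ?thesis by simp
    next
      case False
      then have "G j = (\<lambda>f. f (u @ take j w) powr s)" "u @ take j w \<in> K j" by (auto simp: G_def K_def)
      moreover from this have "(\<lambda>f. f (u @ take j w)) \<in> borel_measurable (PiM (K j) (\<lambda>_. borel))"
        by (intro measurable_component_singleton)
      ultimately show ?thesis by simp
    qed
  qed
  have Znn: "0 \<le> Z j \<omega>" for j \<omega>
    unfolding Z_def G_def using F0 by simp
  have split: "{..?n} = insert 0 {1..?n}" by auto
  have "indep_vars (\<lambda>_. borel) (\<lambda>j \<omega>. ennreal (Z j \<omega>)) {..?n}"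
    by (rule indep_vars_compose2[OF ind]) simp
  then have *: "(\<integral>\<^sup>+\<omega>. (\<Prod>j\<le>?n. ennreal (Z j \<omega>)) \<partial>M) = (\<Prod>j\<le>?n. \<integral>\<^sup>+\<omega>. ennreal (Z j \<omega>) \<partial>M)"
    by (intro indep_vars_nn_integral) auto
  have "(\<integral>\<^sup>+\<omega>. ennreal (cascade_prod V u w \<omega> powr s * F (cascade_sum V (u @ w) m \<omega>)) \<partial>M)
      = (\<integral>\<^sup>+\<omega>. (\<Prod>j\<le>?n. ennreal (Z j \<omega>)) \<partial>M)"
  proof (rule nn_integral_cong_AE)
    show "AE \<omega> in M. ennreal (cascade_prod V u w \<omega> powr s * F (cascade_sum V (u @ w) m \<omega>))
        = (\<Prod>j\<le>?n. ennreal (Z j \<omega>))"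
      using V_pos
    proof eventually_elim
      case (elim \<omega>)
      have "cascade_prod V u w \<omega> powr s = (\<Prod>j\<in>{1..?n}. V (u @ take j w) \<omega> powr s)"
        unfolding cascade_prod_def by (rule prod_powr_distrib)
      also have "\<dots> = (\<Prod>j\<in>{1..?n}. Z j \<omega>)"
        by (intro prod.cong) (auto simp: ZS)
      finally have "cascade_prod V u w \<omega> powr s * F (cascade_sum V (u @ w) m \<omega>) = (\<Prod>j\<le>?n. Z j \<omega>)"
        unfolding split by (simp add: Z0 mult.commute)
      then show ?case using Znn by (simp add: prod_ennreal)
    qed
  qed
  also have "\<dots> = (\<Prod>j\<le>?n. \<integral>\<^sup>+\<omega>. ennreal (Z j \<omega>) \<partial>M)" by (rule *)
  also have "\<dots> = (\<integral>\<^sup>+\<omega>. ennreal (Z 0 \<omega>) \<partial>M) * (\<Prod>j\<in>{1..?n}. \<integral>\<^sup>+\<omega>. ennreal (Z j \<omega>) \<partial>M)"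
    unfolding split by simp
  also have "(\<Prod>j\<in>{1..?n}. \<integral>\<^sup>+\<omega>. ennreal (Z j \<omega>) \<partial>M) = (\<Prod>j\<in>{1..?n}. ennreal (\<integral>\<omega>. W \<omega> powr s \<partial>M))"
  proof (rule prod.cong)
    fix j assume j: "j \<in> {1..?n}"
    have "(\<integral>\<^sup>+\<omega>. ennreal (Z j \<omega>) \<partial>M) = (\<integral>\<^sup>+\<omega>. ennreal (V (u @ take j w) \<omega> powr s) \<partial>M)"
      using ZS[OF j] by simp
    also have "\<dots> = (\<integral>\<^sup>+\<omega>. ennreal (W \<omega> powr s) \<partial>M)"
      using j by (intro nn_integral_V[of _ "\<lambda>x. ennreal (x powr s)"]) auto
    also have "\<dots> = ennreal (\<integral>\<omega>. W \<omega> powr s \<partial>M)"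
      by (intro nn_integral_eq_integral W_powr_integrable s) auto
    finally show "(\<integral>\<^sup>+\<omega>. ennreal (Z j \<omega>) \<partial>M) = ennreal (\<integral>\<omega>. W \<omega> powr s \<partial>M)" .
  qed simp
  also have "\<dots> = ennreal ((\<integral>\<omega>. W \<omega> powr s \<partial>M) ^ ?n)"
    using W_powr_pos[OF s] by (simp add: ennreal_power)
  finally show ?thesis by (simp add: Z0 mult.commute)
qed

lemma nn_integral_cascade_sum: "(\<integral>\<^sup>+\<omega>. ennreal (cascade_sum V u n \<omega>) \<partial>M) = 1"
proof -
  have "(\<integral>\<^sup>+\<omega>. ennreal (cascade_prod V u w \<omega>) \<partial>M) = 1" for w
  proof -
    have "(\<integral>\<^sup>+\<omega>. ennreal (cascade_prod V u w \<omega>) \<partial>M)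
        = (\<integral>\<^sup>+\<omega>. ennreal (cascade_prod V u w \<omega> powr 1 * 1) \<partial>M)"
      using V_pos by (intro nn_integral_cong_AE)
        (auto elim!: eventually_mono simp: less_imp_le[OF cascade_prod_pos])
    also have "\<dots> = ennreal ((\<integral>\<omega>. W \<omega> powr 1 \<partial>M) ^ length w) * (\<integral>\<^sup>+\<omega>. ennreal 1 \<partial>M)"
      by (rule nn_integral_cascade_prod) auto
    also have "(\<integral>\<omega>. W \<omega> powr 1 \<partial>M) = (\<integral>\<omega>. W \<omega> \<partial>M)"
      using W_pos by (intro integral_cong_AE) (auto elim!: eventually_mono)
    finally show ?thesis by (simp add: W_mean emeasure_space_1)
  qed
  note prod = this
  have "(\<integral>\<^sup>+\<omega>. ennreal (cascade_sum V u n \<omega>) \<partial>M)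
      = (\<integral>\<^sup>+\<omega>. (\<Sum>w\<in>{w. length w = n}. ennreal (1 / 2 ^ n) * ennreal (cascade_prod V u w \<omega>)) \<partial>M)"
  proof (rule nn_integral_cong_AE)
    show "AE \<omega> in M. ennreal (cascade_sum V u n \<omega>)
        = (\<Sum>w\<in>{w. length w = n}. ennreal (1 / 2 ^ n) * ennreal (cascade_prod V u w \<omega>))"
      using V_pos
    proof eventually_elim
      case (elim \<omega>)
      have "0 \<le> cascade_prod V u w \<omega>" for w
        using cascade_prod_pos[OF elim] by (simp add: less_imp_le)
      then show ?case unfolding cascade_sum_def
        by (simp flip: ennreal_mult)
    qed
  qed
  also have "\<dots> = (\<Sum>w\<in>{w :: bool list. length w = n}. ennreal (1 / 2 ^ n))"
    by (simp add: nn_integral_sum nn_integral_cmult prod)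
  also have "\<dots> = ennreal (\<Sum>w\<in>{w :: bool list. length w = n}. 1 / 2 ^ n)"
    by (subst sum_ennreal) auto
  also have "card {w :: bool list. length w = n} = 2 ^ n"
    using card_lists_length_eq[of "UNIV :: bool set" n] by simp
  then have "(\<Sum>w\<in>{w :: bool list. length w = n}. 1 / 2 ^ n) = (1 :: real)"
    by simp
  finally show ?thesis by simp
qed

end

subsection \<open>Convergence in probability and Laplace transforms\<close>

text \<open>Truncating the distance at 1 turns convergence in probability into convergence in mean,
  which yields both almost surely convergent subsequences and convergence of Laplace
  transforms.\<close>

lemma (in prob_space) limit_in_probability_L1:
  assumes lim: "limit_in_probability M X Y"
    and [measurable]: "\<And>n. X n \<in> borel_measurable M" "Y \<in> borel_measurable M"
  shows "(\<lambda>n. \<integral>\<omega>. min \<bar>X n \<omega> - Y \<omega>\<bar> 1 \<partial>M) \<longlonglongrightarrow> 0"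
proof (rule LIMSEQ_I)
  fix e :: real assume e: "0 < e"
  have int: "integrable M (\<lambda>\<omega>. min \<bar>X n \<omega> - Y \<omega>\<bar> 1)" for n
    by (rule integrable_const_bound[where B = 1]) auto
  have "(\<lambda>n. measure M {\<omega> \<in> space M. \<bar>X n \<omega> - Y \<omega>\<bar> > e / 2}) \<longlonglongrightarrow> 0"
    using lim half_gt_zero[OF e] unfolding limit_in_probability_def by blast
  then have "\<exists>N. \<forall>n\<ge>N. norm (measure M {\<omega> \<in> space M. \<bar>X n \<omega> - Y \<omega>\<bar> > e / 2} - 0) < e / 2"
    using e by (intro LIMSEQ_D) auto
  then obtain N where N: "\<And>n. N \<le> n \<Longrightarrow> measure M {\<omega> \<in> space M. \<bar>X n \<omega> - Y \<omega>\<bar> > e / 2} < e / 2"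
    by auto
  have "norm ((\<integral>\<omega>. min \<bar>X n \<omega> - Y \<omega>\<bar> 1 \<partial>M) - 0) < e" if n: "N \<le> n" for n
  proof -
    let ?B = "{\<omega> \<in> space M. \<bar>X n \<omega> - Y \<omega>\<bar> > e / 2}"
    have "(\<integral>\<omega>. min \<bar>X n \<omega> - Y \<omega>\<bar> 1 \<partial>M) \<le> (\<integral>\<omega>. e / 2 + indicator ?B \<omega> \<partial>M)"
    proof (rule integral_mono[OF int])
      show "integrable M (\<lambda>\<omega>. e / 2 + indicator ?B \<omega> :: real)"
        by (intro Bochner_Integration.integrable_add integrable_const integrable_real_indicator)
          (auto simp: emeasure_eq_measure)
      show "min \<bar>X n \<omega> - Y \<omega>\<bar> 1 \<le> e / 2 + indicator ?B \<omega>" if "\<omega> \<in> space M" for \<omega>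
        using that e min.cobounded1[of "\<bar>X n \<omega> - Y \<omega>\<bar>" 1] min.cobounded2[of "\<bar>X n \<omega> - Y \<omega>\<bar>" 1]
        unfolding indicator_def by (simp del: min.cobounded1 min.cobounded2)
    qed
    also have "\<dots> = e / 2 + measure M ?B"
      by (subst Bochner_Integration.integral_add)
        (auto simp: prob_space emeasure_eq_measure intro!: integrable_real_indicator)
    also have "\<dots> < e" using N[OF n] by simp
    finally have "(\<integral>\<omega>. min \<bar>X n \<omega> - Y \<omega>\<bar> 1 \<partial>M) < e" .
    moreover have "0 \<le> (\<integral>\<omega>. min \<bar>X n \<omega> - Y \<omega>\<bar> 1 \<partial>M)"
      by (intro integral_nonneg_AE) auto
    ultimately show ?thesis by simp
  qed
  then show "\<exists>N. \<forall>n\<ge>N. norm ((\<integral>\<omega>. min \<bar>X n \<omega> - Y \<omega>\<bar> 1 \<partial>M) - 0) < e" by blast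
qed

lemma (in prob_space) limit_in_probability_AE_subseq:
  assumes lim: "limit_in_probability M X Y"
    and [measurable]: "\<And>n. X n \<in> borel_measurable M" "Y \<in> borel_measurable M"
  obtains r :: "nat \<Rightarrow> nat" where "strict_mono r" "AE \<omega> in M. (\<lambda>n. X (r n) \<omega>) \<longlonglongrightarrow> Y \<omega>"
proof -
  have "\<exists>r::nat\<Rightarrow>nat. strict_mono r \<and> (AE \<omega> in M. (\<lambda>n. min \<bar>X (r n) \<omega> - Y \<omega>\<bar> 1) \<longlonglongrightarrow> 0)"
  proof (rule tendsto_L1_AE_subseq)
    show "integrable M (\<lambda>\<omega>. min \<bar>X n \<omega> - Y \<omega>\<bar> 1)" for n
      by (rule integrable_const_bound[where B = 1]) auto
    have "norm (min \<bar>X n \<omega> - Y \<omega>\<bar> 1) = min \<bar>X n \<omega> - Y \<omega>\<bar> 1" for n \<omega>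
      by simp
    then show "(\<lambda>n. \<integral>\<omega>. norm (min \<bar>X n \<omega> - Y \<omega>\<bar> 1) \<partial>M) \<longlonglongrightarrow> 0"
      using limit_in_probability_L1[OF assms] by simp
  qed
  then obtain r :: "nat \<Rightarrow> nat" where r: "strict_mono r"
    "AE \<omega> in M. (\<lambda>n. min \<bar>X (r n) \<omega> - Y \<omega>\<bar> 1) \<longlonglongrightarrow> 0" by blast
  from r(2) have "AE \<omega> in M. (\<lambda>n. X (r n) \<omega>) \<longlonglongrightarrow> Y \<omega>"
  proof eventually_elim
    case (elim \<omega>)
    show ?case
    proof (rule tendstoI)
      fix e :: real assume "0 < e"
      then have "eventually (\<lambda>n. min \<bar>X (r n) \<omega> - Y \<omega>\<bar> 1 < min e 1) sequentially"
        using order_tendstoD(2)[OF elim, of "min e 1"] by simp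
      then show "eventually (\<lambda>n. dist (X (r n) \<omega>) (Y \<omega>) < e) sequentially"
        by eventually_elim (auto simp: dist_real_def)
    qed
  qed
  with r(1) that show ?thesis by blast
qed

lemma exp_minus_diff_le:
  fixes a b :: real
  assumes "0 \<le> a" "0 \<le> b"
  shows "\<bar>exp (- a) - exp (- b)\<bar> \<le> min \<bar>a - b\<bar> 1"
proof -
  have *: "exp (- x) - exp (- y) \<le> min (y - x) 1 \<and> exp (- y) \<le> exp (- x)" if "0 \<le> x" "x \<le> y" for x y :: real
  proof -
    have "exp (- x) - exp (- y) = exp (- x) * (1 - exp (- (y - x)))"
      by (simp add: exp_diff exp_minus algebra_simps field_simps)
    also have "\<dots> \<le> 1 * (1 - exp (- (y - x)))"
      using that by (intro mult_right_mono) auto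
    finally have "exp (- x) - exp (- y) \<le> 1 - exp (- (y - x))" by simp
    moreover have "1 - (y - x) \<le> exp (- (y - x))"
      using exp_ge_add_one_self[of "- (y - x)"] by linarith
    moreover have "exp (- x) \<le> 1" "0 \<le> exp (- y)" using that by simp_all
    then have "exp (- x) - exp (- y) \<le> 1" using diff_mono[of "exp (- x)" 1 0 "exp (- y)"] by simp
    ultimately show ?thesis using that by (simp add: min_def)
  qed
  show ?thesis
    using *[of a b] *[of b a] assms by (cases "a \<le> b") (auto simp: abs_if)
qed

text \<open>On the nonnegative half-line \<open>exp (- t * x)\<close> has slope at most
  \<open>t\<close> and oscillation at most 1, so its increments are bounded by \<open>t + 1\<close>
  times the distance truncated at 1.\<close>

lemma (in prob_space) limit_in_probability_laplace:
  assumes lim: "limit_in_probability M X Y"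
    and [measurable]: "\<And>n. X n \<in> borel_measurable M" "Y \<in> borel_measurable M"
    and X0: "\<And>n. AE \<omega> in M. 0 \<le> X n \<omega>" and Y0: "AE \<omega> in M. 0 \<le> Y \<omega>" and t: "0 \<le> t"
  shows "(\<lambda>n. \<integral>\<omega>. exp (- t * X n \<omega>) \<partial>M) \<longlonglongrightarrow> (\<integral>\<omega>. exp (- t * Y \<omega>) \<partial>M)"
proof -
  have int: "integrable M (\<lambda>\<omega>. exp (- t * Z \<omega>))"
    if [measurable]: "Z \<in> borel_measurable M" and Z0: "AE \<omega> in M. 0 \<le> Z \<omega>" for Z
    by (rule integrable_const_bound[where B = 1]) (use Z0 t in \<open>auto elim!: eventually_mono\<close>)
  have intm: "integrable M (\<lambda>\<omega>. min \<bar>X n \<omega> - Y \<omega>\<bar> 1)" for n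
    by (rule integrable_const_bound[where B = 1]) auto
  have bound: "norm ((\<integral>\<omega>. exp (- t * X n \<omega>) \<partial>M) - (\<integral>\<omega>. exp (- t * Y \<omega>) \<partial>M))
      \<le> (t + 1) * (\<integral>\<omega>. min \<bar>X n \<omega> - Y \<omega>\<bar> 1 \<partial>M)" for n
  proof -
    have "norm ((\<integral>\<omega>. exp (- t * X n \<omega>) \<partial>M) - (\<integral>\<omega>. exp (- t * Y \<omega>) \<partial>M))
        = norm (\<integral>\<omega>. exp (- t * X n \<omega>) - exp (- t * Y \<omega>) \<partial>M)"
      using int[OF _ X0] int[OF _ Y0] by (subst Bochner_Integration.integral_diff) auto
    also have "\<dots> \<le> (\<integral>\<omega>. norm (exp (- t * X n \<omega>) - exp (- t * Y \<omega>)) \<partial>M)"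
      by (rule integral_norm_bound)
    also have "\<dots> \<le> (\<integral>\<omega>. (t + 1) * min \<bar>X n \<omega> - Y \<omega>\<bar> 1 \<partial>M)"
    proof (rule integral_mono_AE)
      show "AE \<omega> in M. norm (exp (- t * X n \<omega>) - exp (- t * Y \<omega>)) \<le> (t + 1) * min \<bar>X n \<omega> - Y \<omega>\<bar> 1"
        using X0[of n] Y0
      proof eventually_elim
        case (elim \<omega>)
        have "norm (exp (- t * X n \<omega>) - exp (- t * Y \<omega>)) \<le> min \<bar>t * X n \<omega> - t * Y \<omega>\<bar> 1"
          using exp_minus_diff_le[of "t * X n \<omega>" "t * Y \<omega>"] elim t by simp
        also have "\<bar>t * X n \<omega> - t * Y \<omega>\<bar> = t * \<bar>X n \<omega> - Y \<omega>\<bar>"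
          using t by (simp add: abs_mult flip: right_diff_distrib)
        also have "min (t * \<bar>X n \<omega> - Y \<omega>\<bar>) 1 \<le> (t + 1) * min \<bar>X n \<omega> - Y \<omega>\<bar> 1"
          using t by (auto simp: min_def algebra_simps)
        finally show ?case .
      qed
      show "integrable M (\<lambda>\<omega>. norm (exp (- t * X n \<omega>) - exp (- t * Y \<omega>)))"
        using int[OF _ X0] int[OF _ Y0] by (intro integrable_norm Bochner_Integration.integrable_diff) auto
    qed (use intm in simp)
    finally show ?thesis by simp
  qed
  have "(\<lambda>n. (t + 1) * (\<integral>\<omega>. min \<bar>X n \<omega> - Y \<omega>\<bar> 1 \<partial>M)) \<longlonglongrightarrow> (t + 1) * 0"
    by (intro tendsto_mult_left limit_in_probability_L1[OF lim]) auto
  then have "(\<lambda>n. (t + 1) * (\<integral>\<omega>. min \<bar>X n \<omega> - Y \<omega>\<bar> 1 \<partial>M)) \<longlonglongrightarrow> 0" by simp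
  then have "(\<lambda>n. (\<integral>\<omega>. exp (- t * X n \<omega>) \<partial>M) - (\<integral>\<omega>. exp (- t * Y \<omega>) \<partial>M)) \<longlonglongrightarrow> 0"
    by (rule Lim_null_comparison[rotated]) (use bound in auto)
  then show ?thesis by (simp only: LIM_zero_iff)
qed

text \<open>As a function of \<open>t\<close>, \<open>1 - exp (- t * x)\<close> is concave and
  vanishes at 0, so the slopes of its chords from the origin decrease.\<close>

lemma one_minus_exp_div_antimono:
  fixes x s t :: real
  assumes "0 < s" "s \<le> t"
  shows "(1 - exp (- t * x)) / t \<le> (1 - exp (- s * x)) / s"
proof -
  define l where "l = s / t"
  have l: "0 \<le> l" "l \<le> 1" "s = l * t" unfolding l_def using assms by (auto simp: field_simps)
  have "exp ((1 - l) *\<^sub>R 0 + l *\<^sub>R (- t * x)) \<le> (1 - l) * exp 0 + l * exp (- t * x)"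
    by (rule convex_onD[OF exp_convex]) (use l in auto)
  then have "exp (- s * x) \<le> (1 - l) + l * exp (- t * x)"
    unfolding l(3) by (simp add: mult_ac)
  then have "l * (1 - exp (- t * x)) \<le> 1 - exp (- s * x)"
    by (simp add: algebra_simps)
  then have "t * (l * (1 - exp (- t * x))) \<le> t * (1 - exp (- s * x))"
    using assms by (intro mult_left_mono) auto
  then have "s * (1 - exp (- t * x)) \<le> t * (1 - exp (- s * x))"
    unfolding l(3) by (simp only: mult_ac)
  then show ?thesis using assms by (simp add: field_simps)
qed

text \<open>For \<open>x > 1\<close> a single term suffices, the one with
  \<open>2 ^ k \<le> x < 2 ^ (k + 1)\<close>: there \<open>1 - exp (- x / 2 ^ k)\<close> is at least
  \<open>1 - exp (- 1)\<close>, hence at least 1/2, which the factor 2 makes up for. The summand 1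
  deals with \<open>x \<le> 1\<close>.\<close>

lemma powr_le_dyadic_sum:
  assumes x: "0 \<le> x" and s: "0 < s"
  shows "ennreal (x powr s) \<le> 1 + (\<Sum>k. ennreal (2 * 2 powr (s * (real k + 1)) * (1 - exp (- (1 / 2 ^ k) * x))))"
proof (cases "x \<le> 1")
  case True
  then have "ennreal (x powr s) \<le> 1" using x s powr_le1[of s x] by (simp add: ennreal_le_1)
  then show ?thesis by (meson add_increasing2 order.trans zero_le order_refl)
next
  case False
  define k where "k = nat \<lfloor>log 2 x\<rfloor>"
  have lx: "0 \<le> log 2 x" using False by simp
  then have k: "real k \<le> log 2 x" "log 2 x < real k + 1" unfolding k_def by linarith+
  have k1: "2 ^ k \<le> x" using k(1) False by (simp add: le_log_iff powr_realpow)
  have k2: "x \<le> 2 powr (real k + 1)" using k(2) False by (simp add: log_less_iff)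
  have "x powr s \<le> (2 powr (real k + 1)) powr s"
    using k2 False s by (intro powr_mono2) auto
  also have "\<dots> = 2 powr (s * (real k + 1))" by (simp add: powr_powr mult.commute)
  finally have a: "x powr s \<le> 2 powr (s * (real k + 1))" .
  have e1: "2 * exp (- 1 :: real) \<le> 1"
    using exp_ge_add_one_self[of 1] by (simp add: exp_minus field_simps)
  have "1 \<le> 1 / 2 ^ k * x" using k1 by simp
  then have "exp (- (1 / 2 ^ k) * x) \<le> exp (- 1)" by simp
  moreover have "1 \<le> 2 * (1 - z)" if "z \<le> exp (- 1)" for z :: real
  proof -
    have "2 * z \<le> 2 * exp (- 1)" using that by (intro mult_left_mono) auto
    then have "2 * z \<le> 1" using e1 by (rule order_trans)
    then show ?thesis by simp
  qed
  ultimately have "1 \<le> 2 * (1 - exp (- (1 / 2 ^ k) * x))" by blast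
  then have "2 powr (s * (real k + 1)) * 1 \<le> 2 powr (s * (real k + 1)) * (2 * (1 - exp (- (1 / 2 ^ k) * x)))"
    by (intro mult_left_mono) auto
  with a have "x powr s \<le> 2 powr (s * (real k + 1)) * (2 * (1 - exp (- (1 / 2 ^ k) * x)))"
    unfolding mult_1_right by (rule order_trans)
  also have "\<dots> = 2 * 2 powr (s * (real k + 1)) * (1 - exp (- (1 / 2 ^ k) * x))"
    by (simp only: mult_ac)
  finally have "ennreal (x powr s) \<le> ennreal (2 * 2 powr (s * (real k + 1)) * (1 - exp (- (1 / 2 ^ k) * x)))"
    by (rule ennreal_leI)
  also have "\<dots> = (\<Sum>j\<in>{k}. ennreal (2 * 2 powr (s * (real j + 1)) * (1 - exp (- (1 / 2 ^ j) * x))))"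
    by simp
  also have "\<dots> \<le> (\<Sum>k. ennreal (2 * 2 powr (s * (real k + 1)) * (1 - exp (- (1 / 2 ^ k) * x))))"
    by (rule sum_le_suminf) auto
  finally show ?thesis by (meson add_increasing order.trans zero_le order_refl)
qed

text \<open>At \<open>t = 1 / 2 ^ k\<close> the Laplace bound makes the \<open>k\<close>-th dyadic
  term a multiple of \<open>2 powr ((s - a) * k)\<close>, a convergent geometric series because
  \<open>s < a\<close>.\<close>

lemma (in prob_space) nn_integral_powr_le_laplace:
  assumes [measurable]: "Y \<in> borel_measurable M" and Y0: "AE \<omega> in M. 0 \<le> Y \<omega>"
    and g: "\<And>t. 0 < t \<Longrightarrow> t \<le> 1 \<Longrightarrow> (\<integral>\<omega>. 1 - exp (- t * Y \<omega>) \<partial>M) \<le> C * t powr a"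
    and s: "0 < s" "s < a" and C: "0 \<le> C"
  shows "(\<integral>\<^sup>+\<omega>. ennreal (Y \<omega> powr s) \<partial>M)
    \<le> 1 + ennreal (2 * 2 powr s * C / (1 - 2 powr (s - a)))"
proof -
  let ?h = "\<lambda>k \<omega>. 2 * 2 powr (s * (real k + 1)) * (1 - exp (- (1 / 2 ^ k) * Y \<omega>))"
  define c where "c = 2 * 2 powr s * C"
  define b where "b = 2 powr (s - a)"
  have b: "0 < b" "b < 1" unfolding b_def using s powr_less_mono[of "s - a" 0 2] by auto
  have c0: "0 \<le> c" unfolding c_def using C by simp
  have "(\<integral>\<^sup>+\<omega>. ennreal (Y \<omega> powr s) \<partial>M) \<le> (\<integral>\<^sup>+\<omega>. 1 + (\<Sum>k. ennreal (?h k \<omega>)) \<partial>M)"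
  proof (rule nn_integral_mono_AE)
    show "AE \<omega> in M. ennreal (Y \<omega> powr s) \<le> 1 + (\<Sum>k. ennreal (?h k \<omega>))"
      using Y0 by eventually_elim (rule powr_le_dyadic_sum[OF _ s(1)])
  qed
  also have "\<dots> = 1 + (\<Sum>k. \<integral>\<^sup>+\<omega>. ennreal (?h k \<omega>) \<partial>M)"
    by (subst nn_integral_add) (auto simp: nn_integral_suminf emeasure_space_1)
  also have "(\<Sum>k. \<integral>\<^sup>+\<omega>. ennreal (?h k \<omega>) \<partial>M) \<le> (\<Sum>k. ennreal (c * b ^ k))"
  proof (rule suminf_le)
    fix k
    define t :: real where "t = 1 / 2 ^ k"
    have t: "0 < t" "t \<le> 1" unfolding t_def by simp_all
    have nn: "AE \<omega> in M. 0 \<le> 1 - exp (- t * Y \<omega>)"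
      using Y0 t by (auto elim!: eventually_mono)
    have int: "integrable M (\<lambda>\<omega>. 1 - exp (- t * Y \<omega>))"
      by (rule integrable_const_bound[where B = 1]) (use Y0 t in \<open>auto elim!: eventually_mono\<close>)
    have "(\<integral>\<^sup>+\<omega>. ennreal (?h k \<omega>) \<partial>M)
        = (\<integral>\<^sup>+\<omega>. ennreal (2 * 2 powr (s * (real k + 1))) * ennreal (1 - exp (- t * Y \<omega>)) \<partial>M)"
      unfolding t_def by (intro nn_integral_cong) (simp add: ennreal_mult')
    also have "\<dots> = ennreal (2 * 2 powr (s * (real k + 1))) * ennreal (\<integral>\<omega>. 1 - exp (- t * Y \<omega>) \<partial>M)"
      unfolding nn_integral_eq_integral[OF int nn, symmetric] by (rule nn_integral_cmult) simp
    also have "\<dots> \<le> ennreal (2 * 2 powr (s * (real k + 1))) * ennreal (C * t powr a)"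
      by (intro mult_left_mono ennreal_leI g t) auto
    also have "\<dots> = ennreal (2 * 2 powr (s * (real k + 1)) * (C * t powr a))"
      using C by (simp add: ennreal_mult)
    also have "t powr a = 2 powr (- a * real k)"
      unfolding t_def by (simp add: powr_divide powr_minus field_simps flip: powr_realpow powr_powr) (simp add: powr_powr mult.commute)
    then have "2 * 2 powr (s * (real k + 1)) * (C * t powr a) = c * b ^ k"
      unfolding c_def b_def
      by (simp add: powr_add[symmetric] powr_power algebra_simps)
    finally show "(\<integral>\<^sup>+\<omega>. ennreal (?h k \<omega>) \<partial>M) \<le> ennreal (c * b ^ k)" .
  qed auto
  also have "(\<Sum>k. ennreal (c * b ^ k)) = ennreal (c / (1 - b))"
  proof -
    have "(\<lambda>k. c * b ^ k) sums (c * (1 / (1 - b)))"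
      using b by (intro sums_mult geometric_sums) auto
    then show ?thesis
      using c0 b by (subst suminf_ennreal_eq) (auto simp: field_simps)
  qed
  finally show ?thesis unfolding c_def b_def by simp
qed

subsection \<open>Moments of the critical limit\<close>

text \<open>Fatou's lemma, in the form used for every passage from finite stages to limits of
  moments.\<close>

lemma nn_integral_le_of_AE_tendsto:
  fixes f :: "nat \<Rightarrow> 'a \<Rightarrow> ennreal"
  assumes [measurable]: "\<And>n. f n \<in> borel_measurable M"
    and lim: "AE x in M. (\<lambda>n. f n x) \<longlonglongrightarrow> g x"
    and le: "\<And>n. integral\<^sup>N M (f n) \<le> B n" and B: "B \<longlonglongrightarrow> b"
  shows "integral\<^sup>N M g \<le> b"
proof -
  have "integral\<^sup>N M g = (\<integral>\<^sup>+x. liminf (\<lambda>n. f n x) \<partial>M)"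
    using lim by (intro nn_integral_cong_AE) (auto elim!: eventually_mono simp: lim_imp_Liminf)
  also have "\<dots> \<le> liminf (\<lambda>n. integral\<^sup>N M (f n))"
    by (rule nn_integral_liminf) simp
  also have "\<dots> \<le> liminf B"
    using le by (intro Liminf_mono) auto
  also have "\<dots> = b" using B by (simp add: lim_imp_Liminf)
  finally show ?thesis .
qed

section \<open>The recursion for the Laplace transforms of the cascade sums and its limit\<close>

context cascade_model
begin

text \<open>The Laplace transform of \<open>cascade_sum V u n\<close>, given by its recursion. Only
  the law of \<open>W\<close> enters, so the independence of \<open>u\<close> is built in.\<close>

primrec cascade_laplace :: "nat \<Rightarrow> real \<Rightarrow> real" where
  "cascade_laplace 0 t = exp (- t)"
| "cascade_laplace (Suc n) t = (\<integral>\<omega>. cascade_laplace n (t * W \<omega> / 2) \<partial>M)\<^sup>2"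

lemma cascade_laplace_measurable [measurable]: "cascade_laplace n \<in> borel_measurable borel"
proof (induction n)
  case 0
  then show ?case by simp
next
  case (Suc n)
  note [measurable] = Suc
  have "(\<lambda>t. (\<integral>\<omega>. cascade_laplace n (t * W \<omega> / 2) \<partial>M)\<^sup>2) \<in> borel_measurable borel"
    by measurable
  then show ?case by simp
qed

lemma integral_exp_cascade_sum:
  "0 \<le> t \<Longrightarrow> (\<integral>\<omega>. exp (- t * cascade_sum V u n \<omega>) \<partial>M) = cascade_laplace n t"
proof (induction n arbitrary: t u)
  case 0
  then show ?case by (simp add: prob_space)
next
  case (Suc n)
  define D where "D b = insert (u @ [b]) (descendants (u @ [b]))" for b
  \<comment> \<open>The absolute values keep the exponentials below 1 everywhere and not just almost
    everywhere; as weights and sums are almost surely nonnegative, they do not affect the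
    integrals.\<close>
  define H where "H b f = exp (- (t / 2) * \<bar>f (u @ [b])\<bar> * \<bar>cascade_sum coord (u @ [b]) n f\<bar>)" for b f
  define A where "A b \<omega> = exp (- (t / 2) * \<bar>V (u @ [b]) \<omega>\<bar> * \<bar>cascade_sum V (u @ [b]) n \<omega>\<bar>)" for b \<omega>
  have sub: "descendants (u @ [b]) \<subseteq> D b" for b unfolding D_def by blast
  have [measurable]: "V (u @ [b]) \<in> borel_measurable M" for b by (rule V_measurable) simp
  have A_meas [measurable]: "A b \<in> borel_measurable M" for b unfolding A_def by measurable
  have H_meas: "H b \<in> borel_measurable (PiM (D b) (\<lambda>_. borel))" for b
  proof -
    note [measurable] = measurable_cascade_sum_coord[OF sub[of b]]
    have [measurable]: "(\<lambda>f. f (u @ [b])) \<in> borel_measurable (PiM (D b) (\<lambda>_. borel))"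
      by (rule measurable_component_singleton) (simp add: D_def)
    show ?thesis unfolding H_def by measurable
  qed
  have HA: "H b \<circ> (\<lambda>\<omega>. \<lambda>v\<in>D b. V v \<omega>) = A b" for b
    unfolding H_def A_def by (rule ext) (simp add: cascade_sum_coord_restrict[OF sub, unfolded D_def] D_def)
  have "indep_var (PiM (D False) (\<lambda>_. borel)) (\<lambda>\<omega>. \<lambda>v\<in>D False. V v \<omega>)
      (PiM (D True) (\<lambda>_. borel)) (\<lambda>\<omega>. \<lambda>v\<in>D True. V v \<omega>)"
    by (rule indep_var_restrict[OF V_indep]) (auto simp: D_def descendants_def)
  from indep_var_compose[OF this H_meas H_meas]
  have ind: "indep_var borel (A False) borel (A True)" unfolding HA .
  have intA: "integrable M (A b)" for b
    by (rule integrable_const_bound[where B = 1]) (use Suc.prems in \<open>auto simp: A_def\<close>)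
  \<comment> \<open>Within one branch the first weight is independent of the subtree below it.
    Averaging over the subtree first produces the transform of stage \<open>n\<close> at the
    rescaled argument.\<close>
  have EA: "(\<integral>\<omega>. A b \<omega> \<partial>M) = (\<integral>\<omega>. cascade_laplace n (t * W \<omega> / 2) \<partial>M)" for b
  proof -
    define h where "h = (\<lambda>z :: real \<times> real. exp (- (t / 2) * \<bar>fst z\<bar> * \<bar>snd z\<bar>))"
    have "indep_var (PiM {u @ [b]} (\<lambda>_. borel)) (\<lambda>\<omega>. \<lambda>v\<in>{u @ [b]}. V v \<omega>)
      (PiM (descendants (u @ [b])) (\<lambda>_. borel)) (\<lambda>\<omega>. \<lambda>v\<in>descendants (u @ [b]). V v \<omega>)"
      by (rule indep_var_restrict[OF V_indep]) (auto simp: descendants_def)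
    from indep_var_compose[OF this, of "\<lambda>f. f (u @ [b])" borel "cascade_sum coord (u @ [b]) n" borel]
    have "indep_var borel ((\<lambda>f. f (u @ [b])) \<circ> (\<lambda>\<omega>. \<lambda>v\<in>{u @ [b]}. V v \<omega>))
        borel (cascade_sum coord (u @ [b]) n \<circ> (\<lambda>\<omega>. \<lambda>v\<in>descendants (u @ [b]). V v \<omega>))"
      using measurable_cascade_sum_coord[OF order_refl] by (simp add: measurable_component_singleton)
    moreover have "(\<lambda>f. f (u @ [b])) \<circ> (\<lambda>\<omega>. \<lambda>v\<in>{u @ [b]}. V v \<omega>) = V (u @ [b])"
      by auto
    moreover have "cascade_sum coord (u @ [b]) n \<circ> (\<lambda>\<omega>. \<lambda>v\<in>descendants (u @ [b]). V v \<omega>)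
        = cascade_sum V (u @ [b]) n"
      by (rule ext) (simp add: cascade_sum_coord_restrict)
    ultimately have indVY: "indep_var borel (V (u @ [b])) borel (cascade_sum V (u @ [b]) n)" by simp
    have "(\<integral>\<omega>. A b \<omega> \<partial>M) = (\<integral>\<omega>. h (V (u @ [b]) \<omega>, cascade_sum V (u @ [b]) n \<omega>) \<partial>M)"
      unfolding A_def h_def by simp
    also have "\<dots> = (\<integral>\<omega>. (\<integral>\<omega>'. h (V (u @ [b]) \<omega>, cascade_sum V (u @ [b]) n \<omega>') \<partial>M) \<partial>M)"
    proof (rule expectation_indep_var_bounded[OF indVY])
      show "h \<in> borel_measurable (borel \<Otimes>\<^sub>M borel)" unfolding h_def by measurable
      show "\<bar>h z\<bar> \<le> 1" for z unfolding h_def using Suc.prems by simp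
    qed
    also have "\<dots> = (\<integral>\<omega>. cascade_laplace n (t * V (u @ [b]) \<omega> / 2) \<partial>M)"
    proof (rule integral_cong_AE)
      show "(\<lambda>\<omega>. \<integral>\<omega>'. h (V (u @ [b]) \<omega>, cascade_sum V (u @ [b]) n \<omega>') \<partial>M) \<in> borel_measurable M"
        unfolding h_def by measurable
      show "AE \<omega> in M. (\<integral>\<omega>'. h (V (u @ [b]) \<omega>, cascade_sum V (u @ [b]) n \<omega>') \<partial>M)
          = cascade_laplace n (t * V (u @ [b]) \<omega> / 2)"
        using V_pos
      proof eventually_elim
        case (elim \<omega>)
        then have v: "0 < V (u @ [b]) \<omega>" by simp
        have "(\<integral>\<omega>'. h (V (u @ [b]) \<omega>, cascade_sum V (u @ [b]) n \<omega>') \<partial>M)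
            = (\<integral>\<omega>'. exp (- (t * V (u @ [b]) \<omega> / 2) * cascade_sum V (u @ [b]) n \<omega>') \<partial>M)"
        proof (rule integral_cong_AE)
          show "AE \<omega>' in M. h (V (u @ [b]) \<omega>, cascade_sum V (u @ [b]) n \<omega>')
              = exp (- (t * V (u @ [b]) \<omega> / 2) * cascade_sum V (u @ [b]) n \<omega>')"
            using V_pos
          proof eventually_elim
            case (elim \<omega>')
            from cascade_sum_nonneg[OF elim, of "u @ [b]" n] show ?case
              unfolding h_def using v by simp
          qed
        qed (auto simp: h_def)
        also have "\<dots> = cascade_laplace n (t * V (u @ [b]) \<omega> / 2)"
          using v Suc.prems by (intro Suc.IH) auto
        finally show ?case .
      qed
    qed measurable
    also have "\<dots> = (\<integral>\<omega>. cascade_laplace n (t * W \<omega> / 2) \<partial>M)"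
      by (rule integral_V) auto
    finally show ?thesis .
  qed
  have "(\<integral>\<omega>. exp (- t * cascade_sum V u (Suc n) \<omega>) \<partial>M) = (\<integral>\<omega>. A False \<omega> * A True \<omega> \<partial>M)"
  proof (rule integral_cong_AE)
    show "AE \<omega> in M. exp (- t * cascade_sum V u (Suc n) \<omega>) = A False \<omega> * A True \<omega>"
      using V_pos
    proof eventually_elim
      case (elim \<omega>)
      then have "\<bar>V (u @ [b]) \<omega>\<bar> = V (u @ [b]) \<omega>"
          "\<bar>cascade_sum V (u @ [b]) n \<omega>\<bar> = cascade_sum V (u @ [b]) n \<omega>" for b
        by (auto simp: cascade_sum_nonneg intro!: abs_of_pos)
      then show ?case
        unfolding A_def cascade_sum_Suc by (simp add: exp_add[symmetric] field_simps)
    qed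
  qed auto
  also have "\<dots> = (\<integral>\<omega>. A False \<omega> \<partial>M) * (\<integral>\<omega>. A True \<omega> \<partial>M)"
    by (rule indep_var_lebesgue_integral[OF ind intA intA])
  finally show ?case by (simp add: EA power2_eq_square)
qed

lemma cascade_laplace_bounds:
  assumes "0 \<le> t"
  shows "0 \<le> cascade_laplace n t" "cascade_laplace n t \<le> 1"
proof -
  have eq: "cascade_laplace n t = (\<integral>\<omega>. exp (- t * cascade_sum V [] n \<omega>) \<partial>M)"
    using integral_exp_cascade_sum[OF assms] by simp
  show "0 \<le> cascade_laplace n t" unfolding eq by (intro integral_nonneg_AE) auto
  have "(\<integral>\<omega>. exp (- t * cascade_sum V [] n \<omega>) \<partial>M) \<le> (\<integral>\<omega>. 1 \<partial>M)"
  proof (rule integral_mono_AE)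
    show "AE \<omega> in M. exp (- t * cascade_sum V [] n \<omega>) \<le> 1"
      using V_pos by eventually_elim (use assms in \<open>simp add: cascade_sum_nonneg\<close>)
    then show "integrable M (\<lambda>\<omega>. exp (- t * cascade_sum V [] n \<omega>))"
      by (intro integrable_const_bound[where B = 1]) auto
  qed simp
  then show "cascade_laplace n t \<le> 1" unfolding eq by (simp add: prob_space)
qed

text \<open>A modulus of continuity under scaling that is uniform in \<open>n\<close>; it rests on
  \<open>a * exp (- a) \<le> 1\<close> and lets \<open>sqrt n\<close> be exchanged for
  \<open>sqrt (n + 1)\<close>.\<close>

lemma cascade_laplace_scale:
  assumes x: "0 \<le> x" and \<rho>: "1 \<le> \<rho>"
  shows "\<bar>cascade_laplace n x - cascade_laplace n (\<rho> * x)\<bar> \<le> \<rho> - 1"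
proof -
  have x': "0 \<le> \<rho> * x" using x \<rho> by simp
  have int: "integrable M (\<lambda>\<omega>. exp (- y * cascade_sum V [] n \<omega>))" if "0 \<le> y" for y
    by (rule integrable_const_bound[where B = 1])
      (use V_pos that in \<open>auto elim!: eventually_mono simp: cascade_sum_nonneg\<close>)
  have "cascade_laplace n x - cascade_laplace n (\<rho> * x)
      = (\<integral>\<omega>. exp (- x * cascade_sum V [] n \<omega>) - exp (- (\<rho> * x) * cascade_sum V [] n \<omega>) \<partial>M)"
    unfolding integral_exp_cascade_sum[OF x, of "[]" n, symmetric]
      integral_exp_cascade_sum[OF x', of "[]" n, symmetric]
    by (rule Bochner_Integration.integral_diff[symmetric]) (intro int x x')+
  also have "\<bar>\<dots>\<bar> \<le> (\<integral>\<omega>. \<bar>exp (- x * cascade_sum V [] n \<omega>) - exp (- (\<rho> * x) * cascade_sum V [] n \<omega>)\<bar> \<partial>M)"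
    by (rule integral_abs_bound)
  also have "\<dots> \<le> (\<integral>\<omega>. \<rho> - 1 \<partial>M)"
  proof (rule integral_mono_AE)
    show "integrable M (\<lambda>\<omega>. \<bar>exp (- x * cascade_sum V [] n \<omega>) - exp (- (\<rho> * x) * cascade_sum V [] n \<omega>)\<bar>)"
      by (intro integrable_abs Bochner_Integration.integrable_diff int x x')
    show "AE \<omega> in M. \<bar>exp (- x * cascade_sum V [] n \<omega>) - exp (- (\<rho> * x) * cascade_sum V [] n \<omega>)\<bar> \<le> \<rho> - 1"
      using V_pos
    proof eventually_elim
      case (elim \<omega>)
      define a where "a = x * cascade_sum V [] n \<omega>"
      have a: "0 \<le> a" unfolding a_def using x cascade_sum_nonneg[OF elim] by simp
      have "exp (- (\<rho> * a)) = exp (- a) * exp (- ((\<rho> - 1) * a))"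
        by (simp add: exp_add[symmetric] algebra_simps)
      then have "exp (- a) - exp (- (\<rho> * a)) = exp (- a) * (1 - exp (- ((\<rho> - 1) * a)))"
        by (simp add: algebra_simps)
      also have "\<dots> \<le> exp (- a) * ((\<rho> - 1) * a)"
        using exp_ge_add_one_self[of "- ((\<rho> - 1) * a)"] by (intro mult_left_mono) auto
      also have "\<dots> = (a * exp (- a)) * (\<rho> - 1)" by simp
      also have "\<dots> \<le> 1 * (\<rho> - 1)"
      proof (rule mult_right_mono)
        have "a \<le> exp a" using exp_ge_add_one_self[of a] by linarith
        then show "a * exp (- a) \<le> 1" by (simp add: exp_minus field_simps)
      qed (use \<rho> in simp)
      finally have "exp (- a) - exp (- (\<rho> * a)) \<le> \<rho> - 1" by simp
      moreover have "a \<le> \<rho> * a" using a \<rho> mult_right_mono[of 1 \<rho> a] by simp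
      then have "exp (- (\<rho> * a)) \<le> exp (- a)" by simp
      ultimately show ?case
        unfolding a_def by (simp add: mult.assoc)
    qed
  qed simp
  finally show ?thesis by (simp add: prob_space)
qed

lemma critical_moments:
  assumes int2: "integrable M (\<lambda>\<omega>. W \<omega> * ln (W \<omega>))" and crit: "(\<integral>\<omega>. W \<omega> * ln (W \<omega>) \<partial>M) = ln 2"
    and int3: "integrable M (\<lambda>\<omega>. W \<omega> * (ln (W \<omega>))\<^sup>2)"
    and L: "critical_limit M V L" and L0: "\<And>u. AE \<omega> in M. 0 \<le> L u \<omega>"
    and s: "0 < s" "s < 1"
  shows "\<exists>K. \<forall>u. (\<integral>\<^sup>+\<omega>. ennreal (L u \<omega> powr s) \<partial>M) \<le> ennreal K"
proof -
  have L_meas [measurable]: "L u \<in> borel_measurable M" for u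
    using L unfolding critical_limit_def by blast
  have L_lim: "limit_in_probability M (\<lambda>n \<omega>. sqrt (real n) * cascade_sum V u n \<omega>) (L u)" for u
    using L unfolding critical_limit_def by blast
  define \<phi> where "\<phi> t = (\<integral>\<omega>. exp (- t * L [] \<omega>) \<partial>M)" for t
  have conv_u: "(\<lambda>n. cascade_laplace n (sqrt (real n) * t)) \<longlonglongrightarrow> (\<integral>\<omega>. exp (- t * L u \<omega>) \<partial>M)"
    if t: "0 \<le> t" for t u
  proof -
    have "(\<lambda>n. \<integral>\<omega>. exp (- t * (sqrt (real n) * cascade_sum V u n \<omega>)) \<partial>M) \<longlonglongrightarrow> (\<integral>\<omega>. exp (- t * L u \<omega>) \<partial>M)"
    proof (rule limit_in_probability_laplace[OF L_lim _ _ _ L0 t])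
      show "AE \<omega> in M. 0 \<le> sqrt (real n) * cascade_sum V u n \<omega>" for n
        using V_pos by eventually_elim (simp add: cascade_sum_nonneg)
    qed auto
    moreover have "(\<integral>\<omega>. exp (- t * (sqrt (real n) * cascade_sum V u n \<omega>)) \<partial>M) = cascade_laplace n (sqrt (real n) * t)" for n
      using integral_exp_cascade_sum[of "sqrt (real n) * t" u n] t by (simp add: mult_ac)
    ultimately show ?thesis by simp
  qed
  \<comment> \<open>Both transforms are limits of the same sequence, which does not involve
    \<open>u\<close>; this makes the final moment bound uniform in \<open>u\<close>.\<close>
  have phi_u: "(\<integral>\<omega>. exp (- t * L u \<omega>) \<partial>M) = \<phi> t" if "0 \<le> t" for t u
    unfolding \<phi>_def by (rule LIMSEQ_unique[OF conv_u conv_u]) fact+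
  have conv: "(\<lambda>n. cascade_laplace n (sqrt (real n) * t)) \<longlonglongrightarrow> \<phi> t" if "0 \<le> t" for t
    using conv_u[OF that, of "[]"] unfolding \<phi>_def .
  \<comment> \<open>The recursion expresses stage \<open>n + 1\<close>, normalised by
    \<open>sqrt (n + 1)\<close>, through stage \<open>n\<close> with that same factor instead of its
    own \<open>sqrt n\<close>. The mismatch disappears because the quotient of the two factors tends
    to 1.\<close>
  have conv': "(\<lambda>n. cascade_laplace n (sqrt (real (Suc n)) * t)) \<longlonglongrightarrow> \<phi> t" if t: "0 \<le> t" for t
  proof -
    have "(\<lambda>n. cascade_laplace n (sqrt (real n) * t) - cascade_laplace n (sqrt (real (Suc n)) * t)) \<longlonglongrightarrow> 0"
    proof (rule Lim_null_comparison)
      show "(\<lambda>n. sqrt (real (Suc n)) / sqrt (real n) - 1) \<longlonglongrightarrow> 0" by real_asymp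
      show "eventually (\<lambda>n. norm (cascade_laplace n (sqrt (real n) * t) - cascade_laplace n (sqrt (real (Suc n)) * t))
          \<le> sqrt (real (Suc n)) / sqrt (real n) - 1) sequentially"
        using eventually_gt_at_top[of 0]
      proof eventually_elim
        case (elim n)
        have "1 \<le> sqrt (real (Suc n)) / sqrt (real n)" using elim by simp
        from cascade_laplace_scale[OF _ this, of "sqrt (real n) * t" n] t elim
        show ?case by simp
      qed
    qed
    from tendsto_diff[OF conv[OF t] this] show ?thesis by simp
  qed
  have phi_meas [measurable]: "\<phi> \<in> borel_measurable borel" unfolding \<phi>_def by measurable
  have fix_phi: "\<phi> t = (\<integral>\<omega>. \<phi> (t * W \<omega> / 2) \<partial>M)\<^sup>2" if t: "0 \<le> t" for t
  proof -
    have "(\<lambda>n. \<integral>\<omega>. cascade_laplace n (sqrt (real (Suc n)) * (t * W \<omega> / 2)) \<partial>M) \<longlonglongrightarrow> (\<integral>\<omega>. \<phi> (t * W \<omega> / 2) \<partial>M)"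
    proof (rule integral_dominated_convergence[where w = "\<lambda>_. 1"])
      show "AE \<omega> in M. (\<lambda>n. cascade_laplace n (sqrt (real (Suc n)) * (t * W \<omega> / 2))) \<longlonglongrightarrow> \<phi> (t * W \<omega> / 2)"
        using W_pos by eventually_elim (rule conv', use t in simp)
      show "AE \<omega> in M. norm (cascade_laplace n (sqrt (real (Suc n)) * (t * W \<omega> / 2))) \<le> 1" for n
        using W_pos
      proof eventually_elim
        case (elim \<omega>)
        then have "0 \<le> sqrt (real (Suc n)) * (t * W \<omega> / 2)" using t by simp
        from cascade_laplace_bounds[OF this, of n] show ?case by simp
      qed
    qed auto
    then have "(\<lambda>n. (\<integral>\<omega>. cascade_laplace n (sqrt (real (Suc n)) * (t * W \<omega> / 2)) \<partial>M)\<^sup>2) \<longlonglongrightarrow> (\<integral>\<omega>. \<phi> (t * W \<omega> / 2) \<partial>M)\<^sup>2"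
      by (rule tendsto_power)
    moreover have "(\<lambda>n. cascade_laplace (Suc n) (sqrt (real (Suc n)) * t)) \<longlonglongrightarrow> \<phi> t"
      using LIMSEQ_Suc[OF conv[OF t]] .
    ultimately show ?thesis
      by (intro LIMSEQ_unique[of _ "\<phi> t"]) (simp_all add: mult.assoc)
  qed
  define g where "g t = 1 - \<phi> t" for t
  have int_exp: "integrable M (\<lambda>\<omega>. exp (- t * L u \<omega>))" if "0 \<le> t" for t u
    by (rule integrable_const_bound[where B = 1]) (use L0[of u] that in \<open>auto elim!: eventually_mono\<close>)
  have g_eq: "g t = (\<integral>\<omega>. 1 - exp (- t * L u \<omega>) \<partial>M)" if "0 \<le> t" for t u
    unfolding g_def phi_u[OF that, of u, symmetric]
    using int_exp[OF that, of u] by (simp add: prob_space)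
  have int_g: "integrable M (\<lambda>\<omega>. 1 - exp (- t * L u \<omega>))" if "0 \<le> t" for t u
    using int_exp[OF that] by simp
  \<comment> \<open>Any \<open>a\<close> strictly between \<open>s\<close> and 1 would do:
    \<open>a < 1\<close> for the growth estimate, \<open>s < a\<close> for the convergence of the
    dyadic series.\<close>
  define a where "a = (1 + s) / 2"
  have a: "s < a" "a < 1" unfolding a_def using s by simp_all
  have "\<exists>C. \<forall>t. 0 < t \<and> t \<le> 1 \<longrightarrow> g t \<le> C * t powr a"
  \<comment> \<open>If \<open>L []\<close> vanishes almost surely, so does \<open>g\<close>, and the
    growth lemma, which asks for positive \<open>g\<close>, is replaced by a trivial bound.\<close>
  proof (cases "AE \<omega> in M. L [] \<omega> = 0")
    case True
    have "g t = 0" for t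
      unfolding g_def \<phi>_def using True
      by (subst integral_cong_AE[where g = "\<lambda>_. 1"]) (auto elim!: eventually_mono simp: prob_space)
    then show ?thesis by (intro exI[of _ 0]) simp
  next
    case False
    have "\<exists>C. \<forall>t. 0 < t \<and> t \<le> 1 \<longrightarrow> g t \<le> C * t powr (1 - (1 - a))"
    proof (rule smoothing_fixed_point_growth[OF W_measurable W_pos W_nonconst W_integrable W_mean int2 crit int3])
      show "g \<in> borel_measurable borel" unfolding g_def by measurable
      show gpos: "0 < g t" if t: "0 < t" for t
      proof -
        have nn: "AE \<omega> in M. 0 \<le> 1 - exp (- t * L [] \<omega>)"
          using L0[of "[]"] by eventually_elim (use t in simp)
        have "g t \<noteq> 0"
        proof
          assume "g t = 0"
          then have "AE \<omega> in M. 1 - exp (- t * L [] \<omega>) = 0"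
            using integral_nonneg_eq_0_iff_AE[OF int_g nn] t g_eq[of t "[]"] by simp
          then have "AE \<omega> in M. L [] \<omega> = 0" by eventually_elim (use t in simp)
          with False show False by simp
        qed
        moreover have "0 \<le> g t" using integral_nonneg_AE[OF nn] t g_eq[of t "[]"] by simp
        ultimately show ?thesis by simp
      qed
      show "g t \<le> 1" if "0 < t" for t
        unfolding g_def \<phi>_def by (simp add: integral_nonneg_AE)
      show "g r \<le> g t" if "0 < r" "r \<le> t" for r t
      proof -
        have "(\<integral>\<omega>. 1 - exp (- r * L [] \<omega>) \<partial>M) \<le> (\<integral>\<omega>. 1 - exp (- t * L [] \<omega>) \<partial>M)"
        proof (rule integral_mono_AE)
          show "AE \<omega> in M. 1 - exp (- r * L [] \<omega>) \<le> 1 - exp (- t * L [] \<omega>)"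
            using L0[of "[]"] by eventually_elim (use that in \<open>simp add: mult_right_mono\<close>)
        qed (use that int_g in auto)
        then show ?thesis using g_eq[of _ "[]"] that by simp
      qed
      show "g t / t \<le> g r / r" if "0 < r" "r \<le> t" for r t
      proof -
        have "(\<integral>\<omega>. (1 - exp (- t * L [] \<omega>)) / t \<partial>M) \<le> (\<integral>\<omega>. (1 - exp (- r * L [] \<omega>)) / r \<partial>M)"
          using that int_g[of _ "[]"] by (intro integral_mono one_minus_exp_div_antimono integrable_divide) auto
        then show ?thesis using g_eq[of _ "[]"] that by simp
      qed
      show "(g \<longlongrightarrow> 0) (at_right 0)"
      proof (rule tendsto_at_right_sequentially[of 0 1])
        fix S :: "nat \<Rightarrow> real" assume S: "\<And>n. 0 < S n" "S \<longlonglongrightarrow> 0"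
        have "(\<lambda>n. \<integral>\<omega>. exp (- S n * L [] \<omega>) \<partial>M) \<longlonglongrightarrow> (\<integral>\<omega>. 1 \<partial>M)"
        proof (rule integral_dominated_convergence[where w = "\<lambda>_. 1"])
          have "(\<lambda>n. exp (- S n * L [] \<omega>)) \<longlonglongrightarrow> exp (- 0 * L [] \<omega>)" for \<omega>
            by (intro tendsto_intros S)
          then show "AE \<omega> in M. (\<lambda>n. exp (- S n * L [] \<omega>)) \<longlonglongrightarrow> 1" by simp
          show "AE \<omega> in M. norm (exp (- S n * L [] \<omega>)) \<le> 1" for n
            using L0[of "[]"] by eventually_elim (use S(1)[of n] in simp)
        qed auto
        then have "(\<lambda>n. \<phi> (S n)) \<longlonglongrightarrow> 1" unfolding \<phi>_def by (simp add: prob_space)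
        from tendsto_diff[OF tendsto_const[of 1] this]
        show "(\<lambda>n. g (S n)) \<longlonglongrightarrow> 0" unfolding g_def by simp
      qed simp
      show "g t = (\<integral>\<omega>. g (t * W \<omega> / 2) \<partial>M) * (2 - (\<integral>\<omega>. g (t * W \<omega> / 2) \<partial>M))" if t: "0 < t" for t
      proof -
        have phi01: "0 \<le> \<phi> x \<and> \<phi> x \<le> 1" if x: "0 \<le> x" for x
        proof -
          have "(\<integral>\<omega>. exp (- x * L [] \<omega>) \<partial>M) \<le> (\<integral>\<omega>. 1 \<partial>M)"
            using L0[of "[]"] x int_exp[OF x]
            by (intro integral_mono_AE) (auto elim!: eventually_mono)
          then show ?thesis unfolding \<phi>_def by (simp add: integral_nonneg_AE prob_space)
        qed
        have "integrable M (\<lambda>\<omega>. \<phi> (t * W \<omega> / 2))"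
        proof (rule integrable_const_bound[where B = 1])
          show "AE \<omega> in M. norm (\<phi> (t * W \<omega> / 2)) \<le> 1"
            using W_pos
          proof eventually_elim
            case (elim \<omega>)
            then show ?case using phi01[of "t * W \<omega> / 2"] t by simp
          qed
        qed simp
        then have Eg: "(\<integral>\<omega>. g (t * W \<omega> / 2) \<partial>M) = 1 - (\<integral>\<omega>. \<phi> (t * W \<omega> / 2) \<partial>M)"
          unfolding g_def by (simp add: prob_space)
        have "g t = 1 - (\<integral>\<omega>. \<phi> (t * W \<omega> / 2) \<partial>M)\<^sup>2"
          unfolding g_def using fix_phi[of t] t by simp
        then show ?thesis
          unfolding Eg by (simp add: power2_eq_square algebra_simps)
      qed
      show "0 < 1 - a" using a by simp
    qed
    then show ?thesis by simp
  qed
  then obtain C where C: "\<And>t. 0 < t \<Longrightarrow> t \<le> 1 \<Longrightarrow> g t \<le> C * t powr a" by blast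
  have "(\<integral>\<^sup>+\<omega>. ennreal (L u \<omega> powr s) \<partial>M)
      \<le> 1 + ennreal (2 * 2 powr s * \<bar>C\<bar> / (1 - 2 powr (s - a)))" for u
  proof (rule nn_integral_powr_le_laplace[OF L_meas L0 _ s(1) a(1)])
    fix t :: real assume t: "0 < t" "t \<le> 1"
    have "g t \<le> C * t powr a" using C t by simp
    also have "\<dots> \<le> \<bar>C\<bar> * t powr a" by (intro mult_right_mono) auto
    finally show "(\<integral>\<omega>. 1 - exp (- t * L u \<omega>) \<partial>M) \<le> \<bar>C\<bar> * t powr a"
      using g_eq[of t u] t by simp
  qed simp
  moreover have "2 powr (s - a) < 1" using a powr_less_mono[of "s - a" 0 2] by simp
  then have "1 + ennreal (2 * 2 powr s * \<bar>C\<bar> / (1 - 2 powr (s - a)))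
      = ennreal (1 + 2 * 2 powr s * \<bar>C\<bar> / (1 - 2 powr (s - a)))"
    by (subst ennreal_plus) auto
  ultimately show ?thesis by metis
qed

end

subsection \<open>The exponent and the masses of dyadic intervals\<close>

context cascade_model
begin

lemma W_log_W_le:
  assumes "subcritical M W \<or> critical M W"
  shows "integrable M (\<lambda>\<omega>. W \<omega> * ln (W \<omega>))" "(\<integral>\<omega>. W \<omega> * ln (W \<omega>) \<partial>M) \<le> ln 2"
    and "critical M W \<Longrightarrow> (\<integral>\<omega>. W \<omega> * ln (W \<omega>) \<partial>M) = ln 2"
proof -
  have eq: "W \<omega> * ln (W \<omega>) = ln 2 * (W \<omega> * log 2 (W \<omega>))" for \<omega>
    by (simp add: log_def)
  have int: "integrable M (\<lambda>\<omega>. W \<omega> * log 2 (W \<omega>))"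
    using assms unfolding subcritical_def critical_def by blast
  then show "integrable M (\<lambda>\<omega>. W \<omega> * ln (W \<omega>))"
    unfolding eq by simp
  have I: "(\<integral>\<omega>. W \<omega> * ln (W \<omega>) \<partial>M) = ln 2 * (\<integral>\<omega>. W \<omega> * log 2 (W \<omega>) \<partial>M)"
    unfolding eq by simp
  show "(\<integral>\<omega>. W \<omega> * ln (W \<omega>) \<partial>M) \<le> ln 2"
    unfolding I using assms unfolding subcritical_def critical_def by auto
  show "(\<integral>\<omega>. W \<omega> * ln (W \<omega>) \<partial>M) = ln 2" if "critical M W"
    unfolding I using that unfolding critical_def by simp
qed

definition cascade_exponent :: "real \<Rightarrow> real" where
  "cascade_exponent s = 2 powr s / (\<integral>\<omega>. W \<omega> powr s \<partial>M)"

lemma cascade_exponent_0: "cascade_exponent 0 = 1"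
proof -
  have "(\<integral>\<omega>. W \<omega> powr 0 \<partial>M) = (\<integral>\<omega>. 1 \<partial>M)"
    using W_pos by (intro integral_cong_AE) (auto elim!: eventually_mono)
  then show ?thesis unfolding cascade_exponent_def by (simp add: prob_space)
qed

lemma cascade_exponent_1: "cascade_exponent 1 = 2"
proof -
  have "(\<integral>\<omega>. W \<omega> powr 1 \<partial>M) = (\<integral>\<omega>. W \<omega> \<partial>M)"
    using W_pos by (intro integral_cong_AE) (auto elim!: eventually_mono)
  then show ?thesis unfolding cascade_exponent_def by (simp add: W_mean)
qed

text \<open>With \<open>v = W / 2\<close>, convexity of \<open>s \<mapsto> v powr s\<close> and \<open>v powr t * ln v \<le> v * ln v\<close> bound
  \<open>E (v powr s - v powr t)\<close> from below by \<open>- (t - s) * E (v * ln v) \<ge> 0\<close>.\<close>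
lemma cascade_exponent_strict_mono:
  assumes crit: "subcritical M W \<or> critical M W" and st: "0 \<le> s" "s < t" "t \<le> 1"
  shows "cascade_exponent s < cascade_exponent t"
proof -
  define v where "v \<omega> = W \<omega> / 2" for \<omega>
  have powr_v: "AE \<omega> in M. v \<omega> powr r = W \<omega> powr r / 2 powr r" for r
    using W_pos by eventually_elim (simp add: v_def powr_divide)
  have int_v: "integrable M (\<lambda>\<omega>. v \<omega> powr r)"
    and E_v: "(\<integral>\<omega>. v \<omega> powr r \<partial>M) = 1 / cascade_exponent r" if r: "0 \<le> r" "r \<le> 1" for r
  proof -
    have "integrable M (\<lambda>\<omega>. W \<omega> powr r / 2 powr r)"
      using W_powr_integrable[OF r] by simp
    then show "integrable M (\<lambda>\<omega>. v \<omega> powr r)"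
      using powr_v by (subst integrable_cong_AE[OF _ _ powr_v]) (auto simp: v_def)
    have "(\<integral>\<omega>. v \<omega> powr r \<partial>M) = (\<integral>\<omega>. W \<omega> powr r / 2 powr r \<partial>M)"
      by (rule integral_cong_AE[OF _ _ powr_v]) (auto simp: v_def)
    then show "(\<integral>\<omega>. v \<omega> powr r \<partial>M) = 1 / cascade_exponent r"
      unfolding cascade_exponent_def by simp
  qed
  have vln: "AE \<omega> in M. v \<omega> * ln (v \<omega>) = (W \<omega> * ln (W \<omega>) - ln 2 * W \<omega>) / 2"
    using W_pos by eventually_elim (simp add: v_def ln_div algebra_simps)
  have int_vln: "integrable M (\<lambda>\<omega>. v \<omega> * ln (v \<omega>))"
    using W_log_W_le(1)[OF crit] W_integrable
    by (subst integrable_cong_AE[OF _ _ vln]) (auto simp: v_def)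
  have "(\<integral>\<omega>. v \<omega> * ln (v \<omega>) \<partial>M) = (\<integral>\<omega>. (W \<omega> * ln (W \<omega>) - ln 2 * W \<omega>) / 2 \<partial>M)"
    by (rule integral_cong_AE[OF _ _ vln]) (auto simp: v_def)
  also have "\<dots> = ((\<integral>\<omega>. W \<omega> * ln (W \<omega>) \<partial>M) - ln 2) / 2"
    using W_log_W_le(1)[OF crit] W_integrable by (simp add: W_mean)
  also have "\<dots> \<le> 0" using W_log_W_le(2)[OF crit] by simp
  finally have E_vln: "(\<integral>\<omega>. v \<omega> * ln (v \<omega>) \<partial>M) \<le> 0" .
  define h where "h \<omega> = v \<omega> powr s - v \<omega> powr t + (t - s) * (v \<omega> * ln (v \<omega>))" for \<omega>
  \<comment> \<open>With \<open>z = (s - t) * ln x\<close> the expression equals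
    \<open>x powr t * (exp z - 1 - z)\<close> plus \<open>(t - s) * ((x - x powr t) * ln x)\<close>,
    both nonnegative. The first vanishes only at \<open>x = 1\<close>, so integral 0 of
    \<open>h\<close> would force \<open>W = 2\<close> almost surely. This gives the strict
    inequality.\<close>
  have pt: "0 \<le> x powr s - x powr t + (t - s) * (x * ln x) \<and>
      (x powr s - x powr t + (t - s) * (x * ln x) = 0 \<longrightarrow> x = 1)" if x: "0 < x" for x :: real
  proof -
    define z where "z = (s - t) * ln x"
    have "x powr s = x powr t * exp z"
      unfolding z_def using x by (simp add: powr_def exp_add[symmetric] algebra_simps)
    then have "x powr s - x powr t + (t - s) * (x * ln x)
        = x powr t * (exp z - 1 - z) + (t - s) * ((x - x powr t) * ln x)"
      unfolding z_def by (simp add: algebra_simps)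
    moreover have "0 \<le> (x - x powr t) * ln x"
    proof (cases "1 \<le> x")
      case True
      then have "x powr t \<le> x powr 1" using st by (intro powr_mono) auto
      then show ?thesis using True by simp
    next
      case False
      then have "x powr 1 \<le> x powr t" using st x by (intro powr_mono') auto
      then show ?thesis using False x by (intro mult_nonpos_nonpos) auto
    qed
    then have "0 \<le> (t - s) * ((x - x powr t) * ln x)" using st by simp
    moreover have "0 \<le> x powr t * (exp z - 1 - z)"
    proof (rule mult_nonneg_nonneg)
      show "0 \<le> exp z - 1 - z" using exp_ge_add_one_self[of z] by linarith
    qed simp
    moreover have "x = 1" if "x powr t * (exp z - 1 - z) = 0"
    proof -
      have "exp z = 1 + z" using that x by simp
      then have "ln (exp z) = exp z - 1" unfolding ln_exp by linarith
      then have "exp z = 1" by (intro ln_eq_minus_one) auto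
      then have "z = 0" by simp
      then show ?thesis unfolding z_def using st x by simp
    qed
    ultimately show ?thesis by linarith
  qed
  have nn: "AE \<omega> in M. 0 \<le> h \<omega>"
    using W_pos
  proof eventually_elim
    case (elim \<omega>)
    then have "0 < v \<omega>" by (simp add: v_def)
    from pt[OF this] show ?case unfolding h_def by simp
  qed
  have int_h: "integrable M h"
    unfolding h_def using int_v[of s] int_v[of t] int_vln st by simp
  have "(\<integral>\<omega>. h \<omega> \<partial>M) \<noteq> 0"
  proof
    assume "(\<integral>\<omega>. h \<omega> \<partial>M) = 0"
    then have "AE \<omega> in M. h \<omega> = 0"
      using integral_nonneg_eq_0_iff_AE[OF int_h nn] by simp
    with W_pos have "AE \<omega> in M. W \<omega> = 2"
    proof eventually_elim
      case (elim \<omega>)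
      then have "0 < v \<omega>" by (simp add: v_def)
      from pt[OF this] elim(2) have "v \<omega> = 1" unfolding h_def by simp
      then show ?case by (simp add: v_def)
    qed
    with W_nonconst show False by blast
  qed
  then have "0 < (\<integral>\<omega>. h \<omega> \<partial>M)" using integral_nonneg_AE[OF nn] by linarith
  also have "(\<integral>\<omega>. h \<omega> \<partial>M) = 1 / cascade_exponent s - 1 / cascade_exponent t
      + (t - s) * (\<integral>\<omega>. v \<omega> * ln (v \<omega>) \<partial>M)"
    unfolding h_def using int_v[of s] int_v[of t] int_vln st by (simp add: E_v)
  also have "\<dots> \<le> 1 / cascade_exponent s - 1 / cascade_exponent t"
    using E_vln st by (simp add: mult_nonneg_nonpos)
  finally have "1 / cascade_exponent t < 1 / cascade_exponent s" by simp
  moreover have "0 < cascade_exponent s" "0 < cascade_exponent t"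
    unfolding cascade_exponent_def using W_powr_pos st by simp_all
  ultimately show ?thesis by (simp add: field_simps)
qed

lemma cascade_exponent_continuous: "continuous_on {0..1} cascade_exponent"
proof -
  have "continuous_on {0..1} (\<lambda>s. \<integral>\<omega>. W \<omega> powr s \<partial>M)"
    unfolding continuous_on_sequentially
  proof (intro ballI allI impI)
    fix S :: "nat \<Rightarrow> real" and s assume S: "(\<forall>n. S n \<in> {0..1}) \<and> S \<longlonglongrightarrow> s"
    have "(\<lambda>n. \<integral>\<omega>. W \<omega> powr S n \<partial>M) \<longlonglongrightarrow> (\<integral>\<omega>. W \<omega> powr s \<partial>M)"
    proof (rule integral_dominated_convergence[where w = "\<lambda>\<omega>. 1 + W \<omega>"])
      show "integrable M (\<lambda>\<omega>. 1 + W \<omega>)" using W_integrable by simp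
      show "AE \<omega> in M. (\<lambda>n. W \<omega> powr S n) \<longlonglongrightarrow> W \<omega> powr s"
        using W_pos
      proof eventually_elim
        case (elim \<omega>)
        then show ?case using S by (intro tendsto_powr tendsto_const) auto
      qed
      show "AE \<omega> in M. norm (W \<omega> powr S n) \<le> 1 + W \<omega>" for n
        using W_pos
      proof eventually_elim
        case (elim \<omega>)
        then show ?case using powr_le_one_plus[of "W \<omega>" "S n"] S by simp
      qed
    qed auto
    then show "((\<lambda>s. \<integral>\<omega>. W \<omega> powr s \<partial>M) \<circ> S) \<longlonglongrightarrow> (\<integral>\<omega>. W \<omega> powr s \<partial>M)"
      by (simp add: comp_def)
  qed
  moreover have "(\<integral>\<omega>. W \<omega> powr s \<partial>M) \<noteq> 0" if "s \<in> {0..1}" for s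
    using W_powr_pos[of s] that by auto
  ultimately show ?thesis
    unfolding cascade_exponent_def by (intro continuous_intros) auto
qed

lemma cascade_exponent_unique:
  assumes crit: "subcritical M W \<or> critical M W" and d: "0 \<le> d" "d \<le> 1"
  shows "\<exists>!s. s \<in> {0..1} \<and> 2 powr d = cascade_exponent s"
proof -
  have "1 \<le> (2 :: real) powr d" using d by (simp add: ge_one_powr_ge_zero)
  moreover have "(2 :: real) powr d \<le> 2" using d powr_mono[of d 1 2] by simp
  ultimately obtain s where s: "0 \<le> s" "s \<le> 1" "cascade_exponent s = 2 powr d"
    using IVT'[of cascade_exponent 0 "2 powr d" 1] cascade_exponent_continuous
    by (auto simp: cascade_exponent_0 cascade_exponent_1)
  have "r = s" if "r \<in> {0..1}" "2 powr d = cascade_exponent r" for r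
    using that s cascade_exponent_strict_mono[OF crit, of r s] cascade_exponent_strict_mono[OF crit, of s r]
    by (cases r s rule: linorder_cases) auto
  moreover have "s \<in> {0..1} \<and> 2 powr d = cascade_exponent s" using s by simp
  ultimately show ?thesis by blast
qed

text \<open>At finite stages the expectation factorises. Moments need not converge along with the
  variables, so the power is first truncated at \<open>m\<close>: the truncated moments converge by
  dominated convergence, and Fatou's lemma handles the product. A second use of Fatou's lemma
  removes the truncation.\<close>

lemma nn_integral_cascade_mass:
  assumes s: "0 < s" "s \<le> 1" and a: "\<And>n. 0 \<le> a n"
    and Y [measurable]: "Y \<in> borel_measurable M"
    and lim: "AE \<omega> in M. (\<lambda>n. a n * cascade_sum V (u @ w) (k n) \<omega>) \<longlonglongrightarrow> Y \<omega>"
  shows "(\<integral>\<^sup>+\<omega>. ennreal ((cascade_prod V u w \<omega> * Y \<omega>) powr s) \<partial>M)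
    \<le> ennreal ((\<integral>\<omega>. W \<omega> powr s \<partial>M) ^ length w) * (\<integral>\<^sup>+\<omega>. ennreal (Y \<omega> powr s) \<partial>M)"
proof -
  let ?P = "cascade_prod V u w" and ?c = "ennreal ((\<integral>\<omega>. W \<omega> powr s \<partial>M) ^ length w)"
  define X where "X n \<omega> = a n * cascade_sum V (u @ w) (k n) \<omega>" for n \<omega>
  have [measurable]: "X n \<in> borel_measurable M" for n unfolding X_def by measurable
  have X0: "AE \<omega> in M. \<forall>n. 0 \<le> X n \<omega>"
    using V_pos by eventually_elim (simp add: X_def a cascade_sum_nonneg)
  have lim': "AE \<omega> in M. (\<lambda>n. min (X n \<omega> powr s) m) \<longlonglongrightarrow> min (Y \<omega> powr s) m" for m
    using lim X0
  proof eventually_elim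
    case (elim \<omega>)
    have "(\<lambda>n. X n \<omega> powr s) \<longlonglongrightarrow> Y \<omega> powr s"
      using elim s unfolding X_def[symmetric] by (intro tendsto_powr' tendsto_const) auto
    then show ?case by (intro tendsto_min tendsto_const)
  qed
  have bounded: "(\<integral>\<^sup>+\<omega>. ennreal (?P \<omega> powr s * min (Y \<omega> powr s) (real m)) \<partial>M)
      \<le> ?c * (\<integral>\<^sup>+\<omega>. ennreal (Y \<omega> powr s) \<partial>M)" for m :: nat
  proof -
    have "(\<integral>\<^sup>+\<omega>. ennreal (?P \<omega> powr s * min (Y \<omega> powr s) (real m)) \<partial>M)
        \<le> ?c * (\<integral>\<^sup>+\<omega>. ennreal (min (Y \<omega> powr s) (real m)) \<partial>M)"
    proof (rule nn_integral_le_of_AE_tendsto)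
      show "AE \<omega> in M. (\<lambda>n. ennreal (?P \<omega> powr s * min (X n \<omega> powr s) (real m)))
          \<longlonglongrightarrow> ennreal (?P \<omega> powr s * min (Y \<omega> powr s) (real m))"
        using lim'[of "real m"] by eventually_elim (intro tendsto_ennrealI tendsto_mult_left)
      show "(\<integral>\<^sup>+\<omega>. ennreal (?P \<omega> powr s * min (X n \<omega> powr s) (real m)) \<partial>M)
          \<le> ?c * (\<integral>\<^sup>+\<omega>. ennreal (min (X n \<omega> powr s) (real m)) \<partial>M)" for n
        unfolding X_def
        by (rule eq_refl, rule nn_integral_cascade_prod[of s "\<lambda>x. min ((a n * x) powr s) (real m)"])
          (use s in auto)
      have "(\<lambda>n. \<integral>\<^sup>+\<omega>. ennreal (min (X n \<omega> powr s) (real m)) \<partial>M)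
          \<longlonglongrightarrow> (\<integral>\<^sup>+\<omega>. ennreal (min (Y \<omega> powr s) (real m)) \<partial>M)"
      proof (rule nn_integral_dominated_convergence[where w = "\<lambda>_. ennreal (real m)"])
        show "AE \<omega> in M. (\<lambda>n. ennreal (min (X n \<omega> powr s) (real m))) \<longlonglongrightarrow> ennreal (min (Y \<omega> powr s) (real m))"
          using lim'[of "real m"] by eventually_elim (intro tendsto_ennrealI)
        show "(\<integral>\<^sup>+\<omega>. ennreal (real m) \<partial>M) < \<infinity>" by (simp add: emeasure_space_1)
      qed (auto intro!: ennreal_leI)
      then show "(\<lambda>n. ?c * (\<integral>\<^sup>+\<omega>. ennreal (min (X n \<omega> powr s) (real m)) \<partial>M))
          \<longlonglongrightarrow> ?c * (\<integral>\<^sup>+\<omega>. ennreal (min (Y \<omega> powr s) (real m)) \<partial>M)"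
        by (intro ennreal_tendsto_cmult) simp_all
    qed simp
    also have "\<dots> \<le> ?c * (\<integral>\<^sup>+\<omega>. ennreal (Y \<omega> powr s) \<partial>M)"
      by (intro mult_left_mono nn_integral_mono ennreal_leI) auto
    finally show ?thesis .
  qed
  have Y0: "AE \<omega> in M. 0 \<le> Y \<omega>"
    using lim X0
  proof eventually_elim
    case (elim \<omega>)
    then show ?case unfolding X_def by (intro LIMSEQ_le_const[of _ "Y \<omega>"]) auto
  qed
  show ?thesis
  proof (rule nn_integral_le_of_AE_tendsto[OF _ _ bounded tendsto_const])
    show "AE \<omega> in M. (\<lambda>m. ennreal (?P \<omega> powr s * min (Y \<omega> powr s) (real m)))
        \<longlonglongrightarrow> ennreal ((?P \<omega> * Y \<omega>) powr s)"
      using V_pos Y0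
    proof eventually_elim
      case (elim \<omega>)
      obtain m0 :: nat where m0: "Y \<omega> powr s \<le> real m0" using real_arch_simple by blast
      have "eventually (\<lambda>m. ennreal (?P \<omega> powr s * min (Y \<omega> powr s) (real m)) = ennreal ((?P \<omega> * Y \<omega>) powr s)) sequentially"
        using eventually_ge_at_top[of m0]
      proof eventually_elim
        case (elim m)
        then have "Y \<omega> powr s \<le> real m" using m0 by simp
        then show ?case by (simp add: powr_mult)
      qed
      then show ?case by (rule tendsto_eventually)
    qed
  qed simp
qed

end

section \<open>From the masses of dyadic intervals to the dimension of the image\<close>

lemma measure_initial_interval_diff_le:
  fixes N :: "real measure"
  assumes sets: "sets N = sets (restrict_space borel {0..1})" and fin: "finite_measure N"
    and x: "x \<in> dyadic_interval w" and y: "y \<in> dyadic_interval w"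
  shows "\<bar>measure N {0..<x} - measure N {0..<y}\<bar> \<le> measure N (dyadic_interval w)"
proof -
  interpret finite_measure N by (rule fin)
  have meas: "A \<in> sets N" if "A \<in> sets borel" "A \<subseteq> {0..1}" for A
    unfolding sets using that by (subst sets_restrict_space_iff) auto
  have *: "\<bar>measure N {0..<x} - measure N {0..<y}\<bar> \<le> measure N (dyadic_interval w)"
    if "x \<le> y" "x \<in> dyadic_interval w" "y \<in> dyadic_interval w" for x y
  proof -
    have xy: "0 \<le> x" "y \<le> 1" using that dyadic_interval_subset_unit[of w] by auto
    have "measure N ({0..<x} \<union> {x..<y}) = measure N {0..<x} + measure N {x..<y}"
      using xy that(1) by (intro finite_measure_Union meas) auto
    also have "{0..<x} \<union> {x..<y} = {0..<y}" using xy that(1) by auto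
    finally have "measure N {0..<y} - measure N {0..<x} = measure N {x..<y}" by simp
    moreover have "measure N {x..<y} \<le> measure N (dyadic_interval w)"
      by (intro finite_measure_mono meas dyadic_interval_convex that dyadic_interval_borel dyadic_interval_subset_unit)
    moreover have "0 \<le> measure N {x..<y}" by simp
    ultimately show ?thesis by linarith
  qed
  show ?thesis
    using *[of x y] *[of y x] x y by (cases "x \<le> y") (auto simp: abs_minus_commute)
qed

text \<open>Grouped by generation, the integral becomes a series of finite sums, which is measurable
  in the random parameter and can be integrated term by term.\<close>

lemma nn_integral_words_meeting:
  "(\<integral>\<^sup>+w. F w \<partial>count_space {w. dyadic_interval w \<inter> E \<noteq> {}})
    = (\<Sum>n. \<Sum>w\<in>words_meeting E n. F w)"
proof -
  let ?T = "{w. dyadic_interval w \<inter> E \<noteq> {}}"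
  have "(\<Sum>n. F w * indicator (words_meeting E n) w) = F w" if "w \<in> ?T" for w
  proof -
    have "(\<Sum>n. F w * indicator (words_meeting E n) w)
        = (\<Sum>n\<in>{length w}. F w * indicator (words_meeting E n) w)"
    proof (rule suminf_finite)
      show "F w * indicator (words_meeting E n) w = 0" if "n \<notin> {length w}" for n
        using that by (simp add: words_meeting_def indicator_def)
    qed simp
    moreover have "w \<in> words_meeting E (length w)"
      using that by (simp add: words_meeting_def)
    ultimately show ?thesis by simp
  qed
  then have "(\<integral>\<^sup>+w. F w \<partial>count_space ?T)
      = (\<integral>\<^sup>+w. (\<Sum>n. F w * indicator (words_meeting E n) w) \<partial>count_space ?T)"
    by (intro nn_integral_cong) simp
  also have "\<dots> = (\<Sum>n. \<integral>\<^sup>+w. F w * indicator (words_meeting E n) w \<partial>count_space ?T)"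
    by (rule nn_integral_suminf) simp
  also have "\<dots> = (\<Sum>n. \<Sum>w\<in>words_meeting E n. F w)"
  proof (rule suminf_cong)
    show "(\<integral>\<^sup>+w. F w * indicator (words_meeting E n) w \<partial>count_space ?T)
        = (\<Sum>w\<in>words_meeting E n. F w)" for n
      by (subst nn_integral_count_space'[OF finite_words_meeting[of E n]]) (auto simp: words_meeting_def)
  qed
  finally show ?thesis .
qed

context cascade_model
begin

text \<open>The hypothesis \<open>approx\<close> covers both normalisations: constant factors in the
  subcritical case, square roots along an almost surely convergent subsequence in the critical
  one.\<close>

lemma cascade_image_dim_le:
  assumes s: "0 < s" "s \<le> 1" and E: "E \<subseteq> {0..1}"
    and d: "upper_box_dim E < ereal d" "2 powr d < cascade_exponent s"
    and L [measurable]: "\<And>u. L u \<in> borel_measurable M"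
    and approx: "\<And>u. \<exists>a k. (\<forall>n. 0 \<le> a n) \<and> (AE \<omega> in M. (\<lambda>n. a n * cascade_sum V u (k n) \<omega>) \<longlonglongrightarrow> L u \<omega>)"
    and L0: "\<And>u. AE \<omega> in M. 0 \<le> L u \<omega>"
    and K: "\<And>u. (\<integral>\<^sup>+\<omega>. ennreal (L u \<omega> powr s) \<partial>M) \<le> ennreal K"
    and mu: "cascade_measure M V L \<mu>"
  shows "AE \<omega> in M. upper_box_dim (cascade_function \<mu> \<omega> ` E) \<le> ereal s"
proof -
  define Z where "Z w \<omega> = cascade_prod V [] w \<omega> / 2 ^ length w * L w \<omega>" for w \<omega>
  have [measurable]: "Z w \<in> borel_measurable M" for w unfolding Z_def by measurable
  define b where "b = (\<integral>\<omega>. W \<omega> powr s \<partial>M) / 2 powr s"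
  have W0: "0 < (\<integral>\<omega>. W \<omega> powr s \<partial>M)" using W_powr_pos s by simp
  have b0: "0 < b" unfolding b_def using W0 by simp
  \<comment> \<open>The number of words of generation \<open>n\<close> grows at most like
    \<open>(2 powr d) ^ n\<close>, while the expected power of each mass is at most a constant times
    \<open>b ^ n\<close>. Thus \<open>q\<close> is the ratio of the dominating geometric series, and
    \<open>q < 1\<close> restates \<open>2 powr d < cascade_exponent s\<close>.\<close>
  define q where "q = 2 powr d * b"
  have q: "0 < q" "q < 1"
    unfolding q_def b_def using d(2) W0 by (simp_all add: cascade_exponent_def field_simps)
  have mass: "(\<integral>\<^sup>+\<omega>. ennreal (Z w \<omega> powr s) \<partial>M) \<le> ennreal (\<bar>K\<bar> * b ^ length w)" for w
  proof -
    let ?n = "length w"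
    obtain a k where a: "\<And>n. 0 \<le> a n"
      "AE \<omega> in M. (\<lambda>n. a n * cascade_sum V ([] @ w) (k n) \<omega>) \<longlonglongrightarrow> L w \<omega>"
      using approx[of w] by auto
    have pw: "(2 ^ ?n :: real) powr s = (2 powr s) ^ ?n"
      by (simp add: powr_power powr_realpow[symmetric] powr_powr mult.commute)
    have "(\<integral>\<^sup>+\<omega>. ennreal (Z w \<omega> powr s) \<partial>M)
        = (\<integral>\<^sup>+\<omega>. ennreal (1 / (2 powr s) ^ ?n) * ennreal ((cascade_prod V [] w \<omega> * L w \<omega>) powr s) \<partial>M)"
      by (rule nn_integral_cong)
        (simp add: Z_def powr_divide powr_mult pw flip: ennreal_mult)
    also have "\<dots> = ennreal (1 / (2 powr s) ^ ?n) * (\<integral>\<^sup>+\<omega>. ennreal ((cascade_prod V [] w \<omega> * L w \<omega>) powr s) \<partial>M)"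
      by (rule nn_integral_cmult) simp
    also have "\<dots> \<le> ennreal (1 / (2 powr s) ^ ?n) * (ennreal ((\<integral>\<omega>. W \<omega> powr s \<partial>M) ^ ?n) * ennreal \<bar>K\<bar>)"
    proof (intro mult_left_mono)
      have "(\<integral>\<^sup>+\<omega>. ennreal ((cascade_prod V [] w \<omega> * L w \<omega>) powr s) \<partial>M)
          \<le> ennreal ((\<integral>\<omega>. W \<omega> powr s \<partial>M) ^ ?n) * (\<integral>\<^sup>+\<omega>. ennreal (L w \<omega> powr s) \<partial>M)"
        by (rule nn_integral_cascade_mass[OF s a(1) L a(2)])
      also have "\<dots> \<le> ennreal ((\<integral>\<omega>. W \<omega> powr s \<partial>M) ^ ?n) * ennreal \<bar>K\<bar>"
        by (intro mult_left_mono order_trans[OF K] ennreal_leI) auto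
      finally show "(\<integral>\<^sup>+\<omega>. ennreal ((cascade_prod V [] w \<omega> * L w \<omega>) powr s) \<partial>M)
          \<le> ennreal ((\<integral>\<omega>. W \<omega> powr s \<partial>M) ^ ?n) * ennreal \<bar>K\<bar>" .
    qed simp
    also have "\<dots> = ennreal (\<bar>K\<bar> * b ^ ?n)"
      using W0 unfolding b_def by (simp add: power_divide mult.commute flip: ennreal_mult)
    finally show ?thesis .
  qed
  define A where "A \<omega> = (\<Sum>n. \<Sum>w\<in>words_meeting E n. ennreal (Z w \<omega> powr s))" for \<omega>
  have [measurable]: "A \<in> borel_measurable M" unfolding A_def by measurable
  have "(\<integral>\<^sup>+\<omega>. A \<omega> \<partial>M) = (\<Sum>n. \<Sum>w\<in>words_meeting E n. \<integral>\<^sup>+\<omega>. ennreal (Z w \<omega> powr s) \<partial>M)"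
    unfolding A_def by (subst nn_integral_suminf) (auto simp: nn_integral_sum simp del: sum_ennreal)
  also have "\<dots> \<le> (\<Sum>n. \<Sum>w\<in>words_meeting E n. ennreal (\<bar>K\<bar> * b ^ length w))"
    by (intro suminf_le sum_mono mass) auto
  also have "\<dots> = (\<Sum>n. ennreal (real (card (words_meeting E n)) * (\<bar>K\<bar> * b ^ n)))"
  proof (intro suminf_cong)
    fix n
    have "(\<Sum>w\<in>words_meeting E n. ennreal (\<bar>K\<bar> * b ^ length w)) = (\<Sum>w\<in>words_meeting E n. ennreal (\<bar>K\<bar> * b ^ n))"
      by (intro sum.cong) (auto simp: words_meeting_def)
    also have "\<dots> = ennreal (\<Sum>w\<in>words_meeting E n. \<bar>K\<bar> * b ^ n)"
      using b0 by (subst sum_ennreal) auto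
    finally show "(\<Sum>w\<in>words_meeting E n. ennreal (\<bar>K\<bar> * b ^ length w))
        = ennreal (real (card (words_meeting E n)) * (\<bar>K\<bar> * b ^ n))" by simp
  qed
  also have "\<dots> < \<infinity>"
  proof -
    have "summable (\<lambda>n. real (card (words_meeting E n)) * (\<bar>K\<bar> * b ^ n))"
    proof (rule summable_comparison_test_ev)
      show "summable (\<lambda>n. 4 * \<bar>K\<bar> * q ^ n)"
        using q by (intro summable_mult summable_geometric) simp
      show "eventually (\<lambda>n. norm (real (card (words_meeting E n)) * (\<bar>K\<bar> * b ^ n)) \<le> 4 * \<bar>K\<bar> * q ^ n) sequentially"
        using card_words_meeting_bound[OF E d(1)]
      proof eventually_elim
        case (elim n)
        have "norm (real (card (words_meeting E n)) * (\<bar>K\<bar> * b ^ n)) = real (card (words_meeting E n)) * (\<bar>K\<bar> * b ^ n)"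
          using b0 by simp
        also have "\<dots> \<le> 4 * (2 powr d) ^ n * (\<bar>K\<bar> * b ^ n)"
          using elim b0 by (intro mult_right_mono) auto
        finally show ?case unfolding q_def by (simp add: power_mult_distrib mult_ac)
      qed
    qed
    then show ?thesis using b0 by (subst suminf_ennreal2) auto
  qed
  finally have "(\<integral>\<^sup>+\<omega>. A \<omega> \<partial>M) < \<infinity>" .
  then have "AE \<omega> in M. A \<omega> \<noteq> \<infinity>" by (intro nn_integral_PInf_AE) auto
  moreover have "AE \<omega> in M. \<forall>u. 0 \<le> L u \<omega>"
    using L0 by (subst AE_all_countable) auto
  moreover have "AE \<omega> in M. sets (\<mu> \<omega>) = sets (restrict_space borel {0..1}) \<and>
        (\<forall>w. emeasure (\<mu> \<omega>) (dyadic_interval w) = ennreal (Z w \<omega>))"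
    using mu unfolding cascade_measure_def Z_def .
  ultimately show ?thesis
    using V_pos
  proof eventually_elim
    case (elim \<omega>)
    have sets: "sets (\<mu> \<omega>) = sets (restrict_space borel {0..1})" using elim by simp
    have Z0: "0 \<le> Z w \<omega>" for w
      unfolding Z_def using elim cascade_prod_pos[of \<omega> "[]" w] by simp
    have meas: "measure (\<mu> \<omega>) (dyadic_interval w) = Z w \<omega>" for w
      using elim Z0[of w] by (simp add: measure_def)
    have "space (\<mu> \<omega>) = {0..1}"
      using sets_eq_imp_space_eq[OF sets] by (simp add: space_restrict_space)
    then have "emeasure (\<mu> \<omega>) (space (\<mu> \<omega>)) = ennreal (Z [] \<omega>)"
      using elim by (metis dyadic_interval_Nil)
    then have fin: "finite_measure (\<mu> \<omega>)" by (intro finite_measureI) simp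
    have "upper_box_dim ((\<lambda>x. measure (\<mu> \<omega>) {0..<x}) ` E) \<le> ereal s"
    proof (rule upper_box_dim_image_le[OF E s(1), where Z = "\<lambda>w. Z w \<omega>"])
      show "\<bar>measure (\<mu> \<omega>) {0..<x} - measure (\<mu> \<omega>) {0..<y}\<bar> \<le> Z w \<omega>"
        if "x \<in> dyadic_interval w" "y \<in> dyadic_interval w" for w x y
        using measure_initial_interval_diff_le[OF sets fin that] unfolding meas .
      show "(\<integral>\<^sup>+w. ennreal (Z w \<omega> powr s) \<partial>count_space {w. dyadic_interval w \<inter> E \<noteq> {}}) < \<infinity>"
        unfolding nn_integral_words_meeting A_def[symmetric] using elim by (simp add: less_top)
    qed
    then show ?case unfolding cascade_function_def .
  qed
qed

text \<open>This serves \<open>s = 1\<close>, where no larger exponent with controlled moments of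
  \<open>L\<close> is at hand.\<close>

lemma cascade_image_dim_le_1:
  assumes "cascade_measure M V L \<mu>"
  shows "AE \<omega> in M. upper_box_dim (cascade_function \<mu> \<omega> ` E) \<le> 1"
  using assms unfolding cascade_measure_def
proof eventually_elim
  case (elim \<omega>)
  have "space (\<mu> \<omega>) = {0..1}"
    using sets_eq_imp_space_eq[of "\<mu> \<omega>"] elim by (simp add: space_restrict_space)
  then have "emeasure (\<mu> \<omega>) (space (\<mu> \<omega>)) \<noteq> \<infinity>"
    using elim[THEN conjunct2, rule_format, of "[]"] by (simp add: dyadic_interval_Nil)
  then interpret finite_measure "\<mu> \<omega>" by (rule finite_measureI)
  have "cascade_function \<mu> \<omega> ` E \<subseteq> {0..measure (\<mu> \<omega>) (space (\<mu> \<omega>))}"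
    unfolding cascade_function_def by (auto intro: bounded_measure)
  then show ?case by (rule upper_box_dim_bounded_real_le_1) simp
qed

lemma subcritical_approximation:
  assumes "subcritical_limit M V L"
  shows "\<exists>a k. (\<forall>n. 0 \<le> a n) \<and> (AE \<omega> in M. (\<lambda>n. a n * cascade_sum V u (k n) \<omega>) \<longlonglongrightarrow> L u \<omega>)"
  using assms unfolding subcritical_limit_def
  by (intro exI[of _ "\<lambda>_. 1"] exI[of _ "\<lambda>n. n"]) auto

text \<open>Passing to a subsequence is harmless, since the moment estimate for the masses needs
  \<open>L u\<close> only as some almost sure limit of rescaled sums.\<close>

lemma critical_approximation:
  assumes "critical_limit M V L"
  shows "\<exists>a k. (\<forall>n. 0 \<le> a n) \<and> (AE \<omega> in M. (\<lambda>n. a n * cascade_sum V u (k n) \<omega>) \<longlonglongrightarrow> L u \<omega>)"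
proof -
  have [measurable]: "L u \<in> borel_measurable M"
    and lim: "limit_in_probability M (\<lambda>n \<omega>. sqrt (real n) * cascade_sum V u n \<omega>) (L u)"
    using assms unfolding critical_limit_def by blast+
  obtain r :: "nat \<Rightarrow> nat" where "AE \<omega> in M. (\<lambda>n. sqrt (real (r n)) * cascade_sum V u (r n) \<omega>) \<longlonglongrightarrow> L u \<omega>"
    by (rule limit_in_probability_AE_subseq[OF lim]) auto
  then show ?thesis
    by (intro exI[of _ "\<lambda>n. sqrt (real (r n))"] exI[of _ r]) auto
qed

lemma approximated_limit_nonneg:
  assumes "\<exists>a k. (\<forall>n. 0 \<le> a n) \<and> (AE \<omega> in M. (\<lambda>n. a n * cascade_sum V u (k n) \<omega>) \<longlonglongrightarrow> Y \<omega>)"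
  shows "AE \<omega> in M. 0 \<le> Y \<omega>"
proof -
  from assms obtain a :: "nat \<Rightarrow> real" and k :: "nat \<Rightarrow> nat" where a: "\<And>n. 0 \<le> a n"
    "AE \<omega> in M. (\<lambda>n. a n * cascade_sum V u (k n) \<omega>) \<longlonglongrightarrow> Y \<omega>" by blast
  from a(2) V_pos show ?thesis
  proof eventually_elim
    case (elim \<omega>)
    then show ?case
      by (intro LIMSEQ_le_const[of _ "Y \<omega>"]) (auto intro!: exI[of _ 0] mult_nonneg_nonneg a(1) cascade_sum_nonneg)
  qed
qed

text \<open>The sums have mean 1, so Fatou's lemma gives \<open>L u\<close> mean at most 1, and
  \<open>x powr s \<le> 1 + x\<close> bounds the moment by 2.\<close>

lemma subcritical_moments:
  assumes L: "subcritical_limit M V L" and s: "0 < s" "s \<le> 1"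
  shows "(\<integral>\<^sup>+\<omega>. ennreal (L u \<omega> powr s) \<partial>M) \<le> ennreal 2"
proof -
  have [measurable]: "L u \<in> borel_measurable M"
    and lim: "AE \<omega> in M. (\<lambda>n. cascade_sum V u n \<omega>) \<longlonglongrightarrow> L u \<omega>"
    using L unfolding subcritical_limit_def by blast+
  have mean: "(\<integral>\<^sup>+\<omega>. ennreal (L u \<omega>) \<partial>M) \<le> 1"
  proof (rule nn_integral_le_of_AE_tendsto[OF _ _ eq_refl[OF nn_integral_cascade_sum] tendsto_const])
    show "AE \<omega> in M. (\<lambda>n. ennreal (cascade_sum V u n \<omega>)) \<longlonglongrightarrow> ennreal (L u \<omega>)"
      using lim by eventually_elim (rule tendsto_ennrealI)
  qed simp
  have "(\<integral>\<^sup>+\<omega>. ennreal (L u \<omega> powr s) \<partial>M) \<le> (\<integral>\<^sup>+\<omega>. 1 + ennreal (L u \<omega>) \<partial>M)"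
  proof (rule nn_integral_mono_AE)
    show "AE \<omega> in M. ennreal (L u \<omega> powr s) \<le> 1 + ennreal (L u \<omega>)"
      using approximated_limit_nonneg[OF subcritical_approximation[OF L], of u]
    proof eventually_elim
      case (elim \<omega>)
      have "L u \<omega> powr s \<le> 1 + L u \<omega>"
        using elim s by (intro powr_le_one_plus) auto
      then have "ennreal (L u \<omega> powr s) \<le> ennreal (1 + L u \<omega>)" by (rule ennreal_leI)
      then show ?case using elim by simp
    qed
  qed
  also have "\<dots> = 1 + (\<integral>\<^sup>+\<omega>. ennreal (L u \<omega>) \<partial>M)"
    by (subst nn_integral_add) (auto simp: emeasure_space_1)
  also have "\<dots> \<le> 1 + 1" using mean by (intro add_left_mono)
  finally show ?thesis by simp
qed

end

theorem theorem1p3: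
  fixes M :: "'a measure" and W :: "'a \<Rightarrow> real"
    and V L :: "bool list \<Rightarrow> 'a \<Rightarrow> real"
    and \<mu> :: "'a \<Rightarrow> real measure" and E :: "real set"
  assumes "prob_space M"
    and "cascade_generator M W"
    and "cascade_weights M W V"
    and "(subcritical M W \<and> subcritical_limit M V L) \<or>
         (critical M W \<and> (\<exists>t>0. integrable M (\<lambda>\<omega>. W \<omega> powr (- t))) \<and>
          integrable M (\<lambda>\<omega>. W \<omega> * (ln (W \<omega>))\<^sup>2) \<and> critical_limit M V L)"
    and "cascade_measure M V L \<mu>"
    and "E \<noteq> {}" "compact E" "E \<subseteq> {0..1}"
  shows "(\<exists>!s. s \<in> {0..1} \<and>
            2 powr real_of_ereal (upper_box_dim E) = 2 powr s / (\<integral>\<omega>. W \<omega> powr s \<partial>M)) \<and>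
         (\<forall>s \<in> {0..1}.
            2 powr real_of_ereal (upper_box_dim E) = 2 powr s / (\<integral>\<omega>. W \<omega> powr s \<partial>M) \<longrightarrow>
            (AE \<omega> in M. upper_box_dim (cascade_function \<mu> \<omega> ` E) \<le> ereal s))"
proof -
  interpret cascade_model M W V
    using assms(1-3) by (intro cascade_model.intro cascade_model_axioms.intro)
  have crit: "subcritical M W \<or> critical M W" using assms(4) by blast
  have approx: "\<exists>a k. (\<forall>n. 0 \<le> a n) \<and> (AE \<omega> in M. (\<lambda>n. a n * cascade_sum V u (k n) \<omega>) \<longlonglongrightarrow> L u \<omega>)" for u
    using assms(4) subcritical_approximation critical_approximation by blast
  note L0 = approximated_limit_nonneg[OF approx]
  have L_meas: "L u \<in> borel_measurable M" for u
    using assms(4) unfolding subcritical_limit_def critical_limit_def by blast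
  have moments: "\<exists>K. \<forall>u. (\<integral>\<^sup>+\<omega>. ennreal (L u \<omega> powr t) \<partial>M) \<le> ennreal K" if t: "0 < t" "t < 1" for t
    using assms(4)
  proof
    assume "subcritical M W \<and> subcritical_limit M V L"
    then show ?thesis using subcritical_moments t by (intro exI[of _ 2]) auto
  next
    assume "critical M W \<and> (\<exists>t>0. integrable M (\<lambda>\<omega>. W \<omega> powr (- t))) \<and>
          integrable M (\<lambda>\<omega>. W \<omega> * (ln (W \<omega>))\<^sup>2) \<and> critical_limit M V L"
    then show ?thesis
      by (intro critical_moments[OF W_log_W_le(1)[OF crit] W_log_W_le(3)[OF crit] _ _ L0 t]) auto
  qed
  obtain d where d: "upper_box_dim E = ereal d" "0 \<le> d" "d \<le> 1"
    using upper_box_dim_nonneg[of E] upper_box_dim_bounded_real_le_1[OF assms(8)]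
    by (cases "upper_box_dim E") auto
  have "AE \<omega> in M. upper_box_dim (cascade_function \<mu> \<omega> ` E) \<le> ereal s"
    if s: "s \<in> {0..1}" "2 powr d = cascade_exponent s" for s
  proof (cases "s = 1")
    case True
    then show ?thesis
      using cascade_image_dim_le_1[OF assms(5), of E] by (simp add: one_ereal_def)
  next
    case False
    \<comment> \<open>Countably many exponents decreasing to \<open>s\<close>, so that the
      exceptional null sets can be united. The shift by 2 keeps even \<open>t 0\<close> below
      1.\<close>
    define t where "t n = s + (1 - s) / real (n + 2)" for n
    have t: "s < t n" "t n < 1" "0 < t n" for n
    proof -
      have s1: "0 < 1 - s" using s(1) False by simp
      then have "0 < (1 - s) / real (n + 2)" "(1 - s) / real (n + 2) < 1 - s"
        using divide_strict_left_mono[of 1 "real (n + 2)" "1 - s"] by simp_all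
      then show "s < t n" "t n < 1" "0 < t n" unfolding t_def using s(1) by auto
    qed
    have "AE \<omega> in M. upper_box_dim (cascade_function \<mu> \<omega> ` E) \<le> ereal (t n)" for n
    proof -
      have "cascade_exponent s < cascade_exponent (t n)"
        using cascade_exponent_strict_mono[OF crit] s(1) t[of n] by simp
      then have less: "2 powr d < cascade_exponent (t n)" using s(2) by simp
      have pos: "0 < cascade_exponent (t n)"
        unfolding cascade_exponent_def using W_powr_pos[of "t n"] t[of n] by simp
      have "d < log 2 (cascade_exponent (t n))"
        using less pos by (simp add: less_log_iff)
      \<comment> \<open>Word counts are bounded by \<open>(2 powr d') ^ n\<close> only for
        \<open>d'\<close> strictly above the dimension; strict monotonicity of the exponent leaves
        room for such a \<open>d'\<close>.\<close>
      then obtain d' where d': "d < d'" "d' < log 2 (cascade_exponent (t n))"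
        using dense by blast
      have "2 powr d' < cascade_exponent (t n)"
        using d'(2) pos by (simp add: less_log_iff)
      moreover have "upper_box_dim E < ereal d'" using d(1) d'(1) by simp
      moreover obtain K where "\<And>u. (\<integral>\<^sup>+\<omega>. ennreal (L u \<omega> powr t n) \<partial>M) \<le> ennreal K"
        using moments[of "t n"] t[of n] by blast
      ultimately show ?thesis
        using t[of n] by (intro cascade_image_dim_le[OF _ _ assms(8) _ _ L_meas approx L0 _ assms(5)]) auto
    qed
    then have "AE \<omega> in M. \<forall>n. upper_box_dim (cascade_function \<mu> \<omega> ` E) \<le> ereal (t n)"
      by (subst AE_all_countable) auto
    then show ?thesis
    proof eventually_elim
      case (elim \<omega>)
      have "t \<longlonglongrightarrow> s" unfolding t_def by real_asymp
      then have "(\<lambda>n. ereal (t n)) \<longlonglongrightarrow> ereal s" by simp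
      then show ?case by (rule LIMSEQ_le_const) (use elim in auto)
    qed
  qed
  then show ?thesis
    using cascade_exponent_unique[OF crit d(2,3)] unfolding d(1) cascade_exponent_def[symmetric] by simp
qed

end
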